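(* Let $G$ be a graph with maximum degree $\Delta$. Then the following hold. (i) $\omega_2'(G)\le 3(\Delta-1)$ if $G$ is $C_4$-free, provided $\Delta\ge 4$. (ii) $\omega_2'(G)\le 10k^2(\Delta-1)$ if $G$ is $C_{2k}$-free, where $k\ge 3$ is an integer. (iii) $\omega_2'(G)\le (2k-1)(\Delta-1)+2$ if $G$ is $\{C_{2k},C_{2k+1},C_{2k+2}\}$-free, where $k\ge 2$ is an integer.
   Context: Graphs are finite and simple. $C_m$ denotes the cycle with $m$ vertices; a graph is $F$-free if it does not contain $F$ as a (not necessarily induced) subgraph, and $\mathcal F$-free, for a set $\mathcal F$ of graphs, if it is $F$-free for every $F\in\mathcal F$. A strong clique of $G$ is a set of edges of $G$ such that any two distinct edges in the set either share an endpoint or are connected by an edge of $G$ (i.e. some edge of $G$ joins an endpoint of one to an endpoint of the other). The strong clique number $\omega_2'(G)$ is the size of a largest strong clique of $G$.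
   Formalization: Part (ii) is stated for Δ ≥ 2 and part (iii) for Δ ≥ 1, since as written (ii) fails for every graph with Δ ≤ 1 (e.g. K_2 has strong clique number 1 but the bound is 0) and (iii) fails for every graph with Δ = 0 (the bound 3 − 2k is negative). *)

theory Defs
  imports Main
begin

record 'a ugraph =
  verts :: "'a set"
  edges :: "'a set set"

definition simple_graph :: "'a ugraph \<Rightarrow> bool" where
  "simple_graph G \<longleftrightarrow> finite (verts G) \<and> edges G \<subseteq> {e. e \<subseteq> verts G \<and> card e = 2}"

definition degree :: "'a ugraph \<Rightarrow> 'a \<Rightarrow> nat" where
  "degree G v = card {e \<in> edges G. v \<in> e}"

text \<open>Inserting 0 only matters for the graph without vertices, whose maximum degree is set to 0.\<close>

definition max_degree :: "'a ugraph \<Rightarrow> nat" where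
  "max_degree G = Max (insert 0 (degree G ` verts G))"

text \<open>This is the cycle with \<open>m\<close> vertices for \<open>m \<ge> 3\<close>; smaller \<open>m\<close> are not meaningful.\<close>

definition cycle_graph :: "nat \<Rightarrow> nat ugraph" where
  "cycle_graph m = \<lparr>verts = {..<m}, edges = {{i, Suc i mod m} | i. i < m}\<rparr>"

definition contains_subgraph :: "'a ugraph \<Rightarrow> 'b ugraph \<Rightarrow> bool" where
  "contains_subgraph G F \<longleftrightarrow>
     (\<exists>\<phi>. inj_on \<phi> (verts F) \<and> \<phi> ` verts F \<subseteq> verts G \<and> (\<forall>e \<in> edges F. \<phi> ` e \<in> edges G))"

definition subgraph_free :: "'b ugraph \<Rightarrow> 'a ugraph \<Rightarrow> bool" where
  "subgraph_free F G \<longleftrightarrow> \<not> contains_subgraph G F"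

definition family_free :: "'b ugraph set \<Rightarrow> 'a ugraph \<Rightarrow> bool" where
  "family_free \<F> G \<longleftrightarrow> (\<forall>F \<in> \<F>. subgraph_free F G)"

definition strong_clique :: "'a ugraph \<Rightarrow> 'a set set \<Rightarrow> bool" where
  "strong_clique G S \<longleftrightarrow> S \<subseteq> edges G \<and>
     (\<forall>e \<in> S. \<forall>f \<in> S. e \<noteq> f \<longrightarrow> e \<inter> f \<noteq> {} \<or> (\<exists>u \<in> e. \<exists>v \<in> f. {u, v} \<in> edges G))"

definition strong_clique_number :: "'a ugraph \<Rightarrow> nat" where
  "strong_clique_number G = Max (card ` {S. strong_clique G S})"

end

theory Submission imports Defs begin

text \<open>
  Fix a strong clique \<open>S\<close>. In all three parts \<open>S\<close> is covered by few vertices, and edges among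
  the covering vertices sharpen the trivial count of \<open>\<Delta>\<close> edges per vertex.

  (i) If a vertex \<open>v\<close> lies on three edges of \<open>S\<close>, then \<open>C\<^sub>4\<close>-freeness forces every other edge of \<open>S\<close> to
  meet \<open>N(v)\<close>, and either at most three of them avoid \<open>v\<close> or a triangle at \<open>v\<close> (or an edge at \<open>v\<close>)
  covers \<open>S\<close>. Otherwise \<open>S\<close> has at most nine edges.

  (ii) Let \<open>M\<close> be a maximum matching inside \<open>S\<close>. Half of its edges have an end adjacent to one
  vertex \<open>u\<close>; call these ends \<open>A\<close> and the opposite ends \<open>B\<close>. Pairwise attachment
  makes one of the graphs inside \<open>A\<close>, inside \<open>B\<close> or between \<open>A\<close> and \<open>B\<close> dense, hence
  it contains a path which \<open>u\<close> closes to a \<open>C\<^sub>2\<^sub>k\<close>, unless \<open>|M| \<le> 32k - 53 \<le> 5k\<^sup>2\<close>.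

  (iii) Consider paths of \<open>G\<close> whose first and last edges lie in \<open>S\<close>. Attachment of these two edges
  rules out such paths on \<open>2k + 2\<close> vertices, whereas an edge of \<open>S\<close> that misses the path can be used
  to prolong it by one or two vertices. So a longest such path on at most \<open>2k\<close> vertices, or one
  step beyond it, has an interior covering \<open>S\<close> up to one edge.
\<close>

lemma finite_edges_of_simple_graph: "simple_graph G \<Longrightarrow> finite (edges G)"
  by (auto simp: simple_graph_def intro: finite_subset[of _ "Pow (verts G)"])

section \<open>Counting edges that meet a vertex set\<close>

lemma strong_clique_number_le:
  assumes "simple_graph G" and "\<And>S. strong_clique G S \<Longrightarrow> card S \<le> n"
  shows "strong_clique_number G \<le> n"
proof -
  have "finite (edges G)" using assms(1) by (rule finite_edges_of_simple_graph)
  then have "finite {S. strong_clique G S}"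
    unfolding strong_clique_def by (auto intro: finite_subset[of _ "Pow (edges G)"])
  moreover have "strong_clique G {}"
    unfolding strong_clique_def by auto
  ultimately show ?thesis
    unfolding strong_clique_number_def using assms(2) by (subst Max_le_iff) auto
qed

lemma list_cycle_in_graph:
  assumes "simple_graph G" "distinct xs" "successively (\<lambda>x y. {x, y} \<in> edges G) xs"
    and "{last xs, hd xs} \<in> edges G" "length xs = m" "m \<ge> 2"
  shows "\<not> subgraph_free (cycle_graph m) G"
proof -
  have step: "{xs ! i, xs ! (Suc i mod m)} \<in> edges G" if "i < m" for i
  proof (cases "Suc i < m")
    case True
    then show ?thesis using assms(3,5) by (simp add: successively_conv_nth)
  next
    case False
    then have "m = Suc i" using that by simp
    then have "i = m - 1" "Suc i mod m = 0" by simp_all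
    moreover have "xs \<noteq> []" using assms(5,6) by auto
    ultimately show ?thesis using assms(4,5) by (simp add: last_conv_nth hd_conv_nth)
  qed
  have "xs ! i \<in> verts G" if "i < m" for i
    using step[OF that] assms(1) by (auto simp: simple_graph_def)
  then have "contains_subgraph G (cycle_graph m)"
    unfolding contains_subgraph_def cycle_graph_def
    using step assms(2,5)
    by (intro exI[of _ "\<lambda>i. xs ! i"]) (auto simp: inj_on_def nth_eq_iff_index_eq)
  then show ?thesis by (simp add: subgraph_free_def)
qed

section \<open>A fixed strong clique in a graph of bounded degree\<close>

locale clique_graph =
  fixes G :: "'a ugraph" and S :: "'a set set" and D :: nat
  assumes simple: "simple_graph G"
    and clique: "strong_clique G S"
    and degree_le: "v \<in> verts G \<Longrightarrow> degree G v \<le> D"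
begin

definition adj :: "'a \<Rightarrow> 'a \<Rightarrow> bool" (infix "\<sim>" 50) where
  "x \<sim> y \<longleftrightarrow> {x, y} \<in> edges G"

text \<open>All edges of \<open>G\<close> at \<open>X\<close> are counted, not only those in
  \<open>S\<close>. A set \<open>X\<close> that meets every edge of \<open>S\<close> bounds
  \<open>card S\<close> by \<open>card (inc X)\<close>, and each edge inside \<open>X\<close> lowers
  the trivial bound \<open>card X * D\<close> by one.\<close>

definition inc :: "'a set \<Rightarrow> 'a set set" where
  "inc X = {e \<in> edges G. e \<inter> X \<noteq> {}}"

lemma adj_sym: "x \<sim> y \<Longrightarrow> y \<sim> x"
  by (simp add: adj_def insert_commute)

lemma adj_neq: "x \<sim> y \<Longrightarrow> x \<noteq> y"
  using simple by (auto simp: adj_def simple_graph_def)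

lemma adj_verts: "x \<sim> y \<Longrightarrow> x \<in> verts G"
  using simple by (auto simp: adj_def simple_graph_def)

lemma finite_edges: "finite (edges G)"
  using simple by (rule finite_edges_of_simple_graph)

lemma S_edges: "S \<subseteq> edges G"
  using clique by (simp add: strong_clique_def)

lemma finite_S: "finite S"
  using S_edges finite_edges finite_subset by blast

lemma S_adj: "{x, y} \<in> S \<Longrightarrow> x \<sim> y"
  using S_edges by (auto simp: adj_def)

lemma S_edgeE:
  assumes "e \<in> S" obtains x y where "e = {x, y}" "x \<noteq> y" "x \<sim> y"
proof -
  have "card e = 2" using assms S_edges simple by (auto simp: simple_graph_def)
  then obtain x y where "e = {x, y}" "x \<noteq> y" by (meson card_2_iff)
  then show ?thesis using that assms S_edges by (auto simp: adj_def)
qed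

lemma S_edge_atE:
  assumes "e \<in> S" "x \<in> e" obtains y where "e = {x, y}" "x \<sim> y"
proof -
  obtain u v where "e = {u, v}" "u \<sim> v" using assms(1) by (rule S_edgeE)
  then show ?thesis using assms(2) that[of u] that[of v] adj_sym by (auto simp: insert_commute)
qed

lemma attached:
  assumes "e \<in> S" "f \<in> S" "e \<inter> f = {}"
  obtains x y where "x \<in> e" "y \<in> f" "x \<sim> y"
proof -
  have "e \<noteq> {}" using assms(1) by (auto elim: S_edgeE)
  then have "e \<noteq> f" using assms(3) by auto
  then show ?thesis using assms clique that unfolding strong_clique_def adj_def by blast
qed

lemma card_edges_at: "card {e \<in> edges G. x \<in> e} \<le> D"
proof (cases "x \<in> verts G")
  case True
  then show ?thesis using degree_le by (simp add: degree_def)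
next
  case False
  then have "{e \<in> edges G. x \<in> e} = {}" using simple by (auto simp: simple_graph_def)
  then show ?thesis by (metis card.empty zero_le)
qed

lemma finite_inc: "finite (inc X)"
  by (simp add: inc_def finite_edges)

lemma card_S_le_inc: "(\<And>e. e \<in> S \<Longrightarrow> e \<inter> X \<noteq> {}) \<Longrightarrow> card S \<le> card (inc X)"
  using S_edges by (intro card_mono finite_inc) (auto simp: inc_def)

text \<open>The edges from \<open>x\<close> to \<open>Y\<close> already belong to
  \<open>inc X\<close>, so \<open>x\<close> contributes at most \<open>D - card Y\<close> new
  ones.\<close>

lemma card_inc_insert:
  assumes "finite X" "Y \<subseteq> X" "x \<notin> X" "\<And>y. y \<in> Y \<Longrightarrow> x \<sim> y"
  shows "card (inc (insert x X)) + card Y \<le> card (inc X) + D"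
proof -
  let ?E = "{e \<in> edges G. x \<in> e}" and ?F = "(\<lambda>y. {x, y}) ` Y"
  have "inc (insert x X) \<subseteq> inc X \<union> (?E - ?F)"
    using assms(2) by (auto simp: inc_def)
  then have "card (inc (insert x X)) \<le> card (inc X \<union> (?E - ?F))"
    by (intro card_mono) (auto simp: finite_inc finite_edges)
  then have 1: "card (inc (insert x X)) \<le> card (inc X) + card (?E - ?F)"
    using card_Un_le order_trans by blast
  have "finite Y" using assms finite_subset by blast
  moreover have "inj_on (\<lambda>y. {x, y}) Y" by (auto simp: inj_on_def doubleton_eq_iff)
  ultimately have "card ?F = card Y" "finite ?F" by (auto simp: card_image)
  moreover have "?F \<subseteq> ?E" using assms(4) by (auto simp: adj_def)
  moreover have "finite ?E" using finite_edges by simp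
  ultimately have "card (?E - ?F) = card ?E - card Y" "card Y \<le> card ?E"
    using card_mono[of ?E ?F] by (simp_all add: card_Diff_subset)
  then show ?thesis using 1 card_edges_at[of x] by linarith
qed

lemma card_inc_empty: "card (inc {}) = 0"
  by (simp add: inc_def)

text \<open>Each vertex but the last saves the edge to its successor; the last saves nothing, whence
  the surplus 1.\<close>

lemma card_inc_path:
  assumes "distinct xs" "successively (\<sim>) xs" "xs \<noteq> []"
  shows "card (inc (set xs)) + length xs \<le> length xs * D + 1"
  using assms
proof (induction xs)
  case Nil
  then show ?case by simp
next
  case (Cons x xs)
  show ?case
  proof (cases "xs = []")
    case True
    then show ?thesis using card_inc_insert[of "{}" "{}" x] card_inc_empty by simp
  next
    case False
    then have "x \<sim> hd xs" "successively (\<sim>) xs"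
      using Cons.prems by (auto simp: successively_Cons)
    then show ?thesis
      using Cons False card_inc_insert[of "set xs" "{hd xs}" x] by simp
  qed
qed

text \<open>Without its first vertex the cycle is a path, and that vertex is adjacent to both ends
  of it. It saves two edges, which cancels the surplus in the count for paths.\<close>

lemma card_inc_cycle:
  assumes "distinct xs" "successively (\<sim>) xs" "last xs \<sim> hd xs" "length xs \<ge> 3"
  shows "card (inc (set xs)) + length xs \<le> length xs * D"
proof -
  obtain x ys where xs: "xs = x # ys" using assms(4) by (cases xs) auto
  obtain y zs where ys: "ys = y # zs" "zs \<noteq> []" using assms(4) xs by (cases ys) (auto simp: Suc_le_length_iff)
  have "last ys \<in> set zs" using ys by simp
  then have "y \<noteq> last ys" using assms(1) xs ys(1) by auto
  moreover have "x \<sim> y" "x \<sim> last ys"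
    using assms xs ys adj_sym by (auto simp: successively_Cons)
  ultimately have "card (inc (set xs)) + 2 \<le> card (inc (set ys)) + D"
    using card_inc_insert[of "set ys" "{y, last ys}" x] assms(1) xs ys by auto
  moreover have "card (inc (set ys)) + length ys \<le> length ys * D + 1"
    using assms xs ys by (intro card_inc_path) (auto simp: successively_Cons)
  ultimately show ?thesis using xs by simp
qed

definition cycle_free :: "nat \<Rightarrow> bool" where
  "cycle_free m \<longleftrightarrow> subgraph_free (cycle_graph m) G"

lemma cycle_freeD:
  assumes "cycle_free m" "distinct xs" "successively (\<sim>) xs" "last xs \<sim> hd xs"
    and "length xs = m" "m \<ge> 2"
  shows False
  using list_cycle_in_graph[OF simple, of xs m] assms
  by (auto simp: cycle_free_def adj_def[abs_def])

end

section \<open>Graphs without 4-cycles\<close>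

locale four_cycle_free = clique_graph +
  assumes cf4: "cycle_free 4"
begin

text \<open>Otherwise \<open>p\<close>, \<open>x\<close>, \<open>q\<close>, \<open>y\<close> is a
  4-cycle.\<close>

lemma common_neighbour_unique:
  assumes "p \<sim> x" "x \<sim> q" "p \<sim> y" "y \<sim> q" "p \<noteq> q"
  shows "x = y"
proof (rule ccontr)
  assume "x \<noteq> y"
  then show False
    using cycle_freeD[OF cf4, of "[p, x, q, y]"] assms adj_sym adj_neq by auto
qed

section \<open>Edges of the clique near a vertex and far from it\<close>

definition sdeg :: "'a \<Rightarrow> nat" where
  "sdeg v = card {e \<in> S. v \<in> e}"

text \<open>The edges of \<open>S\<close> at distance exactly one from \<open>v\<close>; the edges
  of \<open>S\<close> at \<open>v\<close>, these and the far ones partition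
  \<open>S\<close>.\<close>

definition touching :: "'a \<Rightarrow> 'a set set" where
  "touching v = {e \<in> S. v \<notin> e \<and> (\<exists>a\<in>e. v \<sim> a)}"

lemma finite_touching: "finite (touching v)"
  using finite_S by (simp add: touching_def)

text \<open>The vertices \<open>a\<close> and \<open>a'\<close> have \<open>v\<close> as common
  neighbour, hence no other one. This excludes \<open>b = b'\<close> and the cross adjacencies
  \<open>b \<sim> a'\<close>, \<open>a \<sim> b'\<close>, so only two ways of attachment
  remain.\<close>

lemma touching_pair:
  assumes "{a, b} \<in> S" "{a', b'} \<in> S" "v \<sim> a" "v \<sim> a'" "b \<noteq> v" "b' \<noteq> v" "a \<noteq> a'"
  shows "a \<sim> a' \<or> (b \<sim> b' \<and> b \<noteq> b')"
proof (rule ccontr)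
  assume neg: "\<not> ?thesis"
  have ab: "a \<sim> b" "a' \<sim> b'" using assms S_adj by auto
  then have ne: "b \<noteq> a'" "b' \<noteq> a" using neg adj_sym by auto
  have far: "\<not> x \<sim> a'" if "a \<sim> x" "x \<noteq> v" for x
    using common_neighbour_unique[of a x a' v] that assms adj_sym by blast
  have "b \<noteq> b'" using far[OF ab(1)] ab assms adj_sym by auto
  then have "{a, b} \<inter> {a', b'} = {}" using ne assms(7) by auto
  then obtain x y where "x \<in> {a, b}" "y \<in> {a', b'}" "x \<sim> y"
    using attached assms(1,2) by blast
  then have "b \<sim> a' \<or> a \<sim> b'" using neg \<open>b \<noteq> b'\<close> by auto
  then show False using far[of b] far[of b'] ab assms adj_sym by auto
qed

text \<open>Let \<open>A\<close> be the set of neighbours of \<open>v\<close> from which touching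
  edges start. If some \<open>a\<close> in \<open>A\<close> starts two of them, all of
  \<open>A\<close> is adjacent to \<open>a\<close>, and since \<open>a\<close> and \<open>v\<close>
  have at most one common neighbour, one or two vertices cover. Otherwise each element of
  \<open>A\<close> starts a single edge, and four elements would yield a 4-cycle among the opposite
  ends.\<close>

lemma touching_cases:
  obtains "card (touching v) \<le> 3"
  | a where "v \<sim> a" "\<And>e. e \<in> touching v \<Longrightarrow> a \<in> e"
  | a a' where "v \<sim> a" "v \<sim> a'" "a \<sim> a'" "\<And>e. e \<in> touching v \<Longrightarrow> a \<in> e \<or> a' \<in> e"
proof -
  define A where "A = {a. v \<sim> a \<and> (\<exists>b. b \<noteq> v \<and> {a, b} \<in> S)}"
  have touchE: "\<exists>a b. a \<in> A \<and> e = {a, b} \<and> b \<noteq> v \<and> {a, b} \<in> S" if e: "e \<in> touching v" for e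
  proof -
    obtain a where "a \<in> e" "v \<sim> a" "e \<in> S" "v \<notin> e" using e by (auto simp: touching_def)
    moreover then obtain b where "e = {a, b}" using S_edge_atE by blast
    ultimately show ?thesis by (auto simp: A_def)
  qed
  show ?thesis
  proof (cases "\<exists>a b b'. v \<sim> a \<and> b \<noteq> b' \<and> b \<noteq> v \<and> b' \<noteq> v \<and> {a, b} \<in> S \<and> {a, b'} \<in> S")
    case True
    then obtain a b b' where a: "v \<sim> a" "b \<noteq> b'" "b \<noteq> v" "b' \<noteq> v" "{a, b} \<in> S" "{a, b'} \<in> S"
      by blast
    have A_adj: "a \<sim> c" if "c \<in> A" "c \<noteq> a" for c
    proof (rule ccontr)
      assume nadj: "\<not> a \<sim> c"
      obtain d where d: "v \<sim> c" "d \<noteq> v" "{c, d} \<in> S" using \<open>c \<in> A\<close> by (auto simp: A_def)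
      \<comment> \<open>Since \<open>a\<close> and \<open>c\<close> are not adjacent, the opposite
        ends must be; then \<open>a\<close> and \<open>d\<close> share the two neighbours
        \<open>b\<close> and \<open>b'\<close>.\<close>
      have "b \<sim> d" "b' \<sim> d"
        using touching_pair[of a b c d v] touching_pair[of a b' c d v] a d nadj that by auto
      moreover have "a \<noteq> d" using nadj d S_adj adj_sym by auto
      ultimately show False
        using common_neighbour_unique[of a b d b'] a S_adj by blast
    qed
    show ?thesis
    proof (cases "A \<subseteq> {a}")
      case True
      then show ?thesis using that(2)[of a] a(1) touchE by blast
    next
      case False
      then obtain a' where a': "a' \<in> A" "a' \<noteq> a" by blast
      have "A \<subseteq> {a, a'}"
      proof
        fix c assume c: "c \<in> A"
        then have "a' \<sim> v" "c \<sim> v" "a \<noteq> v" using a(1) a'(1) adj_sym adj_neq by (auto simp: A_def)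
        then have "a' = c" if "c \<noteq> a"
          using common_neighbour_unique[of a a' v c] A_adj[OF a'] A_adj[OF c that] by blast
        then show "c \<in> {a, a'}" by blast
      qed
      moreover have "v \<sim> a'" using a'(1) by (simp add: A_def)
      ultimately show ?thesis using that(3)[of a a'] a(1) A_adj[OF a'] touchE by blast
    qed
  next
    case False
    define p where "p a = (SOME b. b \<noteq> v \<and> {a, b} \<in> S)" for a
    have p: "v \<sim> a" "p a \<noteq> v" "{a, p a} \<in> S" if "a \<in> A" for a
      using that someI_ex[of "\<lambda>b. b \<noteq> v \<and> {a, b} \<in> S"] by (auto simp: A_def p_def)
    have touch: "touching v \<subseteq> (\<lambda>a. {a, p a}) ` A"
    proof
      fix e assume "e \<in> touching v"
      then obtain a b where "a \<in> A" "e = {a, b}" "b \<noteq> v" "{a, b} \<in> S" using touchE by blast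
      moreover then have "b = p a" using p[of a] False by blast
      ultimately show "e \<in> (\<lambda>a. {a, p a}) ` A" by blast
    qed
    have "finite A"
    proof (rule finite_subset)
      show "A \<subseteq> verts G" using adj_sym adj_verts by (auto simp: A_def)
      show "finite (verts G)" using simple by (simp add: simple_graph_def)
    qed
    have "card A \<le> 3"
    proof (rule ccontr)
      assume "\<not> card A \<le> 3"
      then obtain B where B: "B \<subseteq> A" "card B = 4"
        using obtain_subset_with_card_n[of 4 A] by auto
      have pair: "a \<sim> b \<or> (p a \<sim> p b \<and> p a \<noteq> p b)" if "a \<in> B" "b \<in> B" "a \<noteq> b" for a b
        using touching_pair[of a "p a" b "p b" v] p[of a] p[of b] that B(1) by auto
      \<comment> \<open>Two neighbours of \<open>a\<close> inside \<open>B\<close> would both be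
        common neighbours of \<open>a\<close> and \<open>v\<close>, so adjacency inside
        \<open>B\<close> is a matching.\<close>
      have matching: "\<not> (a \<sim> b \<and> a \<sim> c)" if "a \<in> B" "b \<in> B" "c \<in> B" "b \<noteq> c" for a b c
        using common_neighbour_unique[of a b v c] p[of a] p[of b] p[of c] that B(1) adj_sym adj_neq
        by blast
      \<comment> \<open>A cyclic order of \<open>B\<close> without adjacent consecutive vertices
        turns, by \<open>pair\<close>, into a 4-cycle on the partners \<open>p\<close>.\<close>
      have no4: False if "{a, b, c, d} \<subseteq> B" "distinct [a, b, c, d]"
        "\<not> a \<sim> b" "\<not> b \<sim> c" "\<not> c \<sim> d" "\<not> d \<sim> a" for a b c d
      proof -
        have ne: "p x \<noteq> p y" if "x \<in> B" "y \<in> B" "x \<noteq> y" for x y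
        proof
          assume eq: "p x = p y"
          have "x \<in> A" "y \<in> A" using that B(1) by auto
          then have "v \<sim> x" "x \<sim> p x" "v \<sim> y" "y \<sim> p x" "v \<noteq> p x"
            using p[of x] p[of y] S_adj eq by metis+
          then show False using common_neighbour_unique that(3) by blast
        qed
        have "p a \<sim> p b" "p b \<sim> p c" "p c \<sim> p d" "p d \<sim> p a"
          using pair that by auto
        then show False
          using common_neighbour_unique[of "p a" "p b" "p c" "p d"] ne[of a c] ne[of b d] that adj_sym
          by auto
      qed
      obtain a b c d where abcd: "B = {a, b, c, d}" "distinct [a, b, c, d]"
      proof -
        have "finite B" using B(2) card.infinite by fastforce
        then obtain xs where xs: "set xs = B" "distinct xs" using finite_distinct_list by blast
        then have "length xs = 4" using B(2) distinct_card by fastforce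
        then obtain a b c d where "xs = [a, b, c, d]"
          by (auto simp: numeral_eq_Suc length_Suc_conv)
        then show ?thesis using that[of a b c d] xs by auto
      qed
      have sym: "b \<sim> a \<longleftrightarrow> a \<sim> b" "c \<sim> a \<longleftrightarrow> a \<sim> c" "d \<sim> a \<longleftrightarrow> a \<sim> d"
        "c \<sim> b \<longleftrightarrow> b \<sim> c" "d \<sim> b \<longleftrightarrow> b \<sim> d" "d \<sim> c \<longleftrightarrow> c \<sim> d"
        using adj_sym by blast+
      have "\<not> (a \<sim> b \<and> a \<sim> c) \<and> \<not> (a \<sim> b \<and> a \<sim> d) \<and> \<not> (a \<sim> c \<and> a \<sim> d)
          \<and> \<not> (b \<sim> a \<and> b \<sim> c) \<and> \<not> (b \<sim> a \<and> b \<sim> d) \<and> \<not> (b \<sim> c \<and> b \<sim> d)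
          \<and> \<not> (c \<sim> a \<and> c \<sim> b) \<and> \<not> (c \<sim> a \<and> c \<sim> d) \<and> \<not> (c \<sim> b \<and> c \<sim> d)
          \<and> \<not> (d \<sim> a \<and> d \<sim> b) \<and> \<not> (d \<sim> a \<and> d \<sim> c) \<and> \<not> (d \<sim> b \<and> d \<sim> c)"
        by (intro conjI; rule matching; use abcd in auto)
      \<comment> \<open>The complement of a matching on four vertices contains a 4-cycle; the
        disjuncts are the three cyclic orders of four vertices.\<close>
      then have "\<not> a \<sim> b \<and> \<not> b \<sim> c \<and> \<not> c \<sim> d \<and> \<not> d \<sim> a
          \<or> \<not> a \<sim> b \<and> \<not> b \<sim> d \<and> \<not> d \<sim> c \<and> \<not> c \<sim> a
          \<or> \<not> a \<sim> c \<and> \<not> c \<sim> b \<and> \<not> b \<sim> d \<and> \<not> d \<sim> a"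
        unfolding sym by argo
      then show False using no4[of a b c d] no4[of a b d c] no4[of a c b d] abcd by auto
    qed
    then have "card (touching v) \<le> 3"
      using touch \<open>finite A\<close> card_mono[OF _ touch] card_image_le[of A "\<lambda>a. {a, p a}"] by fastforce
    then show ?thesis using that(1) by blast
  qed
qed

text \<open>In the covered cases at most two vertices meet all touching edges, and each lies on at
  most two edges of \<open>S\<close>.\<close>

lemma card_touching_le:
  assumes "\<And>x. sdeg x \<le> 2"
  shows "card (touching v) \<le> 4"
proof -
  have two: "card (touching v) \<le> 4" if "\<And>e. e \<in> touching v \<Longrightarrow> a \<in> e \<or> a' \<in> e" for a a'
  proof -
    have "touching v \<subseteq> {e \<in> S. a \<in> e} \<union> {e \<in> S. a' \<in> e}"
      using that by (auto simp: touching_def)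
    then have "card (touching v) \<le> card ({e \<in> S. a \<in> e} \<union> {e \<in> S. a' \<in> e})"
      using finite_S by (intro card_mono) auto
    also have "\<dots> \<le> sdeg a + sdeg a'" unfolding sdeg_def by (rule card_Un_le)
    finally show ?thesis using assms[of a] assms[of a'] by linarith
  qed
  show ?thesis
  proof (rule touching_cases[of v])
    fix a assume "\<And>e. e \<in> touching v \<Longrightarrow> a \<in> e"
    then show ?thesis using two[of a a] by blast
  next
    fix a a' assume "\<And>e. e \<in> touching v \<Longrightarrow> a \<in> e \<or> a' \<in> e"
    then show ?thesis using two[of a a'] by blast
  qed linarith
qed

text \<open>As \<open>f\<close> neither contains \<open>v\<close> nor touches it, its attachments to
  \<open>{v, x}\<close> and \<open>{v, y}\<close> go to \<open>x\<close> and \<open>y\<close>. They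
  use different ends of \<open>f\<close>, because \<open>v\<close> is the only common neighbour of
  \<open>x\<close> and \<open>y\<close>.\<close>

lemma far_edge:
  assumes "f \<in> S" "v \<notin> f" "f \<notin> touching v" "{v, x} \<in> S" "{v, y} \<in> S" "x \<noteq> y"
  obtains a b where "f = {a, b}" "a \<sim> x" "b \<sim> y" "\<not> a \<sim> y" "\<not> b \<sim> x" "a \<noteq> y" "b \<noteq> x" "a \<noteq> b"
proof -
  have vf: "\<And>a. a \<in> f \<Longrightarrow> \<not> v \<sim> a" using assms by (auto simp: touching_def)
  have near: "\<exists>a\<in>f. a \<sim> x" if x: "{v, x} \<in> S" for x
  proof -
    have "{v, x} \<inter> f = {}" using vf S_adj[OF x] assms(2) by auto
    then obtain p q where "p \<in> {v, x}" "q \<in> f" "p \<sim> q" using attached[OF x assms(1)] by blast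
    then show ?thesis using vf adj_sym by auto
  qed
  have one: "\<not> (a \<sim> x \<and> a \<sim> y)" if "a \<in> f" for a
    using common_neighbour_unique[of v x a y] assms S_adj adj_sym that by blast
  obtain a b where ab: "a \<in> f" "a \<sim> x" "b \<in> f" "b \<sim> y" using near assms by metis
  then have "a \<noteq> b" using one by blast
  then have "f = {a, b}" using S_edge_atE[OF assms(1) ab(1)] ab by auto
  moreover have "a \<noteq> y" "b \<noteq> x" using vf ab S_adj assms by auto
  ultimately show ?thesis using that ab one \<open>a \<noteq> b\<close> by blast
qed

text \<open>Orient each far edge from its end near \<open>x\<close> to its end near
  \<open>y\<close>. Cross adjacencies of two far edges close 4-cycles through \<open>x\<close> or
  \<open>y\<close>, so the first ends or the second ends are adjacent. Among the three pairs from
  three far edges one kind occurs twice, and some end then shares two neighbours with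
  \<open>x\<close> or with \<open>y\<close>.\<close>

lemma card_far_edges:
  assumes "{v, x} \<in> S" "{v, y} \<in> S" "x \<noteq> y"
  shows "card {f \<in> S. v \<notin> f \<and> f \<notin> touching v} \<le> 2" (is "card ?F \<le> 2")
proof (rule ccontr)
  assume "\<not> card ?F \<le> 2"
  then obtain T where T: "T \<subseteq> ?F" "card T = 3" using obtain_subset_with_card_n[of 3 ?F] by auto
  then obtain f g h where fgh: "f \<in> ?F" "g \<in> ?F" "h \<in> ?F" "f \<noteq> g" "f \<noteq> h" "g \<noteq> h"
    by (auto simp: card_3_iff)
  define ok where "ok f a b \<longleftrightarrow> f \<in> S \<and> f = {a, b} \<and> a \<sim> x \<and> b \<sim> y \<and> \<not> a \<sim> y \<and> \<not> b \<sim> x \<and>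
    a \<noteq> y \<and> b \<noteq> x \<and> a \<sim> b" for f a b
  have ex: "\<exists>a b. ok f a b" if F: "f \<in> ?F" for f
  proof -
    obtain a b where "f = {a, b}" "a \<sim> x" "b \<sim> y" "\<not> a \<sim> y" "\<not> b \<sim> x" "a \<noteq> y" "b \<noteq> x" "a \<noteq> b"
      using far_edge[OF _ _ _ assms] F by blast
    moreover have "a \<sim> b" using F S_adj \<open>f = {a, b}\<close> by auto
    ultimately show ?thesis using F by (auto simp: ok_def)
  qed
  have pair: "a \<noteq> a' \<and> b \<noteq> b' \<and> (a \<sim> a' \<or> b \<sim> b')" if o: "ok f a b" "ok g a' b'" "f \<noteq> g" for f g a b a' b'
  proof -
    have 1: "b = b'" if "a \<sim> b'" using common_neighbour_unique[of a b y b'] o that by (auto simp: ok_def)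
    have 2: "a = a'" if "a' \<sim> b" using common_neighbour_unique[of b a x a'] o that adj_sym by (auto simp: ok_def)
    have ne: "a \<noteq> a'" "b \<noteq> b'" using 1 2 o by (auto simp: ok_def)
    then have "f \<inter> g = {}" using o by (auto simp: ok_def)
    moreover have "f \<in> S" "g \<in> S" using o by (auto simp: ok_def)
    ultimately obtain p q where "p \<in> f" "q \<in> g" "p \<sim> q" using attached by blast
    then have "a \<sim> a' \<or> a \<sim> b' \<or> b \<sim> a' \<or> b \<sim> b'" using o by (auto simp: ok_def)
    then show ?thesis using ne 1 2[OF adj_sym] by blast
  qed
  obtain a1 b1 a2 b2 a3 b3 where ok: "ok f a1 b1" "ok g a2 b2" "ok h a3 b3"
    using ex fgh by metis
  have A: "a' = a''" if "a \<sim> a'" "a \<sim> a''" "ok f a b" "ok g a' b'" "ok h a'' b''" for f g h a b a' b' a'' b''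
    using common_neighbour_unique[of a a' x a''] that adj_neq by (auto simp: ok_def)
  have B: "b' = b''" if "b \<sim> b'" "b \<sim> b''" "ok f a b" "ok g a' b'" "ok h a'' b''" for f g h a b a' b' a'' b''
    using common_neighbour_unique[of b b' y b''] that adj_neq by (auto simp: ok_def)
  show False
    using pair[OF ok(1,2) fgh(4)] pair[OF ok(1,3) fgh(5)] pair[OF ok(2,3) fgh(6)]
      A[OF _ _ ok(1,2,3)] A[OF _ _ ok(2,1,3)] A[OF _ _ ok(3,1,2)]
      B[OF _ _ ok(1,2,3)] B[OF _ _ ok(2,1,3)] B[OF _ _ ok(3,1,2)] adj_sym
    by metis
qed

text \<open>A far edge would need different ends next to each of \<open>x\<close>, \<open>y\<close>,
  \<open>z\<close>, but has only two. So every edge of \<open>S\<close> contains \<open>v\<close> or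
  touches it, and the cases for touching edges give at most \<open>D + 3\<close>,
  \<open>2 * D - 1\<close> or \<open>3 * D - 3\<close> edges.\<close>

lemma card_S_le_of_sdeg_ge_3:
  assumes "D \<ge> 3" "sdeg v \<ge> 3"
  shows "card S + 3 \<le> 3 * D"
proof -
  obtain T where "T \<subseteq> {e \<in> S. v \<in> e}" "card T = 3"
    using assms(2) obtain_subset_with_card_n unfolding sdeg_def by meson
  then obtain e1 e2 e3 where e: "{e1, e2, e3} \<subseteq> S" "v \<in> e1" "v \<in> e2" "v \<in> e3"
    "e1 \<noteq> e2" "e1 \<noteq> e3" "e2 \<noteq> e3"
    by (auto simp: card_3_iff)
  then obtain x y z where "e1 = {v, x}" "e2 = {v, y}" "e3 = {v, z}"
    using S_edge_atE by (metis insert_subset)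
  then have xyz: "{v, x} \<in> S" "{v, y} \<in> S" "{v, z} \<in> S" "x \<noteq> y" "x \<noteq> z" "y \<noteq> z"
    using e by auto
  have cover: "v \<in> f \<or> f \<in> touching v" if f: "f \<in> S" for f
  proof (rule ccontr)
    assume neg: "\<not> ?thesis"
    obtain a b where ab: "f = {a, b}" "a \<sim> x" "b \<sim> y" "\<not> a \<sim> y" "\<not> b \<sim> x"
      using far_edge[OF f _ _ xyz(1,2,4)] neg by metis
    obtain a' c where ac: "f = {a', c}" "a' \<sim> x" "c \<sim> z" "\<not> a' \<sim> z"
      using far_edge[OF f _ _ xyz(1,3,5)] neg by metis
    obtain b' c' where bc: "f = {b', c'}" "b' \<sim> y" "c' \<sim> z" "\<not> b' \<sim> z"
      using far_edge[OF f _ _ xyz(2,3,6)] neg by metis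
    show False using ab ac bc by (auto simp: doubleton_eq_iff)
  qed
  have one: "card (inc {v}) \<le> D"
    using card_inc_insert[of "{}" "{}" v] card_inc_empty by simp
  show ?thesis
  proof (rule touching_cases[of v])
    assume T: "card (touching v) \<le> 3"
    have "S \<subseteq> inc {v} \<union> touching v" using cover S_edges by (auto simp: inc_def)
    then have "card S \<le> card (inc {v} \<union> touching v)"
      by (intro card_mono) (auto simp: finite_inc finite_touching)
    also have "\<dots> \<le> card (inc {v}) + card (touching v)" by (rule card_Un_le)
    finally show ?thesis using one T assms(1) by linarith
  next
    fix a assume a: "v \<sim> a" "\<And>e. e \<in> touching v \<Longrightarrow> a \<in> e"
    have "card (inc {a, v}) + 1 \<le> 2 * D"
      using card_inc_insert[of "{v}" "{v}" a] one a(1) adj_sym adj_neq by auto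
    moreover have "card S \<le> card (inc {a, v})" using cover a(2) by (intro card_S_le_inc) auto
    ultimately show ?thesis using assms(1) by linarith
  next
    fix a a' assume a: "v \<sim> a" "v \<sim> a'" "a \<sim> a'" "\<And>e. e \<in> touching v \<Longrightarrow> a \<in> e \<or> a' \<in> e"
    have "card (inc {a, v}) + 1 \<le> 2 * D"
      using card_inc_insert[of "{v}" "{v}" a] one a(1) adj_sym adj_neq by auto
    moreover have "card (inc {a', a, v}) + 2 \<le> card (inc {a, v}) + D"
      using card_inc_insert[of "{a, v}" "{a, v}" a'] a adj_sym adj_neq[of v a] adj_neq[of v a'] adj_neq[of a a']
      by auto
    moreover have "card S \<le> card (inc {a', a, v})" using cover a(4) by (intro card_S_le_inc) auto
    ultimately show ?thesis by linarith
  qed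
qed

text \<open>A vertex on two edges of \<open>S\<close> gives the count 2 + 4 + 2. If there is none,
  \<open>S\<close> is a matching and all its edges other than \<open>e\<close> touch an end of
  \<open>e\<close>, which gives 1 + 4 + 4.\<close>

lemma card_S_le_9:
  assumes small: "\<And>x. sdeg x \<le> 2"
  shows "card S \<le> 9"
proof (cases "\<exists>v. sdeg v = 2")
  case True
  then obtain v where v: "sdeg v = 2" by blast
  then obtain e1 e2 where e: "e1 \<in> S" "e2 \<in> S" "v \<in> e1" "v \<in> e2" "e1 \<noteq> e2"
    unfolding sdeg_def by (auto simp: card_2_iff)
  then obtain x y where "e1 = {v, x}" "e2 = {v, y}" using S_edge_atE by metis
  then have far: "card {f \<in> S. v \<notin> f \<and> f \<notin> touching v} \<le> 2"
    using card_far_edges[of v x y] e by auto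
  have "S \<subseteq> {e \<in> S. v \<in> e} \<union> (touching v \<union> {f \<in> S. v \<notin> f \<and> f \<notin> touching v})" by auto
  then have "card S \<le> card ({e \<in> S. v \<in> e} \<union> (touching v \<union> {f \<in> S. v \<notin> f \<and> f \<notin> touching v}))"
    using finite_S finite_touching by (intro card_mono) auto
  also have "\<dots> \<le> sdeg v + (card (touching v) + card {f \<in> S. v \<notin> f \<and> f \<notin> touching v})"
    unfolding sdeg_def by (meson card_Un_le add_left_mono order_trans)
  finally show ?thesis using far v card_touching_le[OF small, of v] by linarith
next
  case False
  show ?thesis
  proof (cases "S = {}")
    case False
    then obtain e where e: "e \<in> S" by blast
    then obtain u v where uv: "e = {u, v}" by (rule S_edgeE)
    have "f \<in> touching u \<union> touching v" if f: "f \<in> S" "f \<noteq> e" for f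
    proof -
      have "w \<notin> f" if w: "w \<in> e" for w
      proof
        assume "w \<in> f"
        then have "{e, f} \<subseteq> {g \<in> S. w \<in> g}" using e f w by auto
        then have "card {e, f} \<le> sdeg w"
          unfolding sdeg_def using finite_S by (intro card_mono) auto
        then have "sdeg w \<ge> 2" using f(2) by auto
        then show False using small[of w] \<open>\<nexists>v. sdeg v = 2\<close> by (metis le_antisym)
      qed
      then have "e \<inter> f = {}" by auto
      then obtain p q where "p \<in> e" "q \<in> f" "p \<sim> q" using attached e f by blast
      then show ?thesis using uv f \<open>e \<inter> f = {}\<close> by (auto simp: touching_def)
    qed
    then have "S \<subseteq> insert e (touching u \<union> touching v)" by auto
    then have "card S \<le> card (insert e (touching u \<union> touching v))"
      using finite_touching by (intro card_mono) auto
    also have "\<dots> \<le> Suc (card (touching u \<union> touching v))" by (rule card_insert_le_m1) auto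
    also have "\<dots> \<le> Suc (card (touching u) + card (touching v))" using card_Un_le by auto
    finally show ?thesis using card_touching_le[OF small, of u] card_touching_le[OF small, of v] by linarith
  qed simp
qed

lemma card_S_le:
  assumes "D \<ge> 4"
  shows "card S + 3 \<le> 3 * D"
proof (cases "\<exists>v. sdeg v \<ge> 3")
  case True
  then show ?thesis using card_S_le_of_sdeg_ge_3 assms by auto
next
  case False
  then have "\<And>x. sdeg x \<le> 2" by (metis not_less_eq_eq numeral_3_eq_3 numeral_2_eq_2)
  then have "card S \<le> 9" by (rule card_S_le_9)
  then show ?thesis using assms by linarith
qed

end

section \<open>Graphs without an even cycle\<close>

lemma min_degree_path:
  assumes "finite T" "x \<in> T" "symp R" "irreflp R"
    and deg: "\<And>y. y \<in> T \<Longrightarrow> n \<le> card {z \<in> T. R y z}"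
  shows "\<exists>xs. length xs = Suc n \<and> distinct xs \<and> set xs \<subseteq> T \<and> successively R xs \<and> last xs = x"
proof -
  have "\<exists>xs. length xs = Suc i \<and> distinct xs \<and> set xs \<subseteq> T \<and> successively R xs \<and> last xs = x"
    if "i \<le> n" for i
    using that
  proof (induction i)
    case 0
    then show ?case using assms(2) by (intro exI[of _ "[x]"]) auto
  next
    case (Suc i)
    then obtain xs where xs: "length xs = Suc i" "distinct xs" "set xs \<subseteq> T" "successively R xs" "last xs = x"
      by auto
    then obtain y ys where ys: "xs = y # ys" by (cases xs) auto
    \<comment> \<open>The head \<open>y\<close> has more neighbours in \<open>T\<close> than there
      are other vertices on the path. Growth takes place at the head so that the prescribed vertex
      \<open>x\<close> stays last.\<close>
    have "card (set ys) = i" using xs ys by (simp add: distinct_card)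
    then have "card (set ys) < card {z \<in> T. R y z}" using deg[of y] Suc.prems xs ys by auto
    then have "\<not> {z \<in> T. R y z} \<subseteq> set ys"
      using card_mono[of "set ys" "{z \<in> T. R y z}"] by auto
    then obtain z where z: "z \<in> T" "R y z" "z \<notin> set ys" by blast
    have "z \<noteq> y" using z(2) assms(4) by (auto dest: irreflpD)
    moreover have "R z y" using z(2) assms(3) by (auto dest: sympD)
    ultimately show ?case using xs ys z by (intro exI[of _ "z # xs"]) auto
  qed
  then show ?thesis by blast
qed

text \<open>Deleting a vertex with at most \<open>d\<close> neighbours destroys at most
  \<open>2 * d\<close> ordered pairs, and a vertex of this kind exists in every nonempty
  rest.\<close>

lemma card_pairs_degenerate:
  assumes "finite V" "symp R"
    and "\<And>T. T \<subseteq> V \<Longrightarrow> T \<noteq> {} \<Longrightarrow> \<exists>x\<in>T. card {y \<in> T. R x y} \<le> d"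
  shows "card {(x, y) \<in> V \<times> V. R x y} \<le> 2 * d * card V"
  using assms(1,3)
proof (induction V rule: finite_psubset_induct)
  case (psubset V)
  show ?case
  proof (cases "V = {}")
    case False
    then obtain x where x: "x \<in> V" "card {y \<in> V. R x y} \<le> d" using psubset.prems[of V] by blast
    let ?N = "{y \<in> V. R x y}" and ?W = "V - {x}"
    have fin: "finite ?N" "finite ?W" using psubset.hyps by auto
    have "{(x, y) \<in> V \<times> V. R x y} \<subseteq> {(x, y) \<in> ?W \<times> ?W. R x y} \<union> (Pair x ` ?N \<union> (\<lambda>y. (y, x)) ` ?N)"
      using assms(2) by (auto dest: sympD)
    then have "card {(x, y) \<in> V \<times> V. R x y}
        \<le> card ({(x, y) \<in> ?W \<times> ?W. R x y} \<union> (Pair x ` ?N \<union> (\<lambda>y. (y, x)) ` ?N))"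
      using fin by (intro card_mono) (auto intro: finite_subset[of _ "?W \<times> ?W"])
    also have "\<dots> \<le> card {(x, y) \<in> ?W \<times> ?W. R x y} + (card (Pair x ` ?N) + card ((\<lambda>y. (y, x)) ` ?N))"
      by (meson card_Un_le add_left_mono order_trans)
    also have "\<dots> \<le> 2 * d * card ?W + (d + d)"
    proof (intro add_mono)
      show "card {(x, y) \<in> ?W \<times> ?W. R x y} \<le> 2 * d * card ?W"
        using x(1) psubset.prems by (intro psubset.IH) auto
    qed (use x(2) card_image_le[OF fin(1)] order_trans in blast)+
    also have "\<dots> = 2 * d * card V"
      using card_Suc_Diff1[OF psubset.hyps(1) x(1)] by (metis mult_2 mult_Suc_right add.commute)
    finally show ?thesis .
  qed simp
qed

text \<open>With so many pairs some nonempty \<open>T\<close> has minimum degree at least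
  \<open>d + 1\<close>, and a greedy path inside \<open>T\<close> reaches \<open>d + 2\<close>
  vertices. The free choice of its last vertex serves bipartite relations, where the side of an end
  matters.\<close>

lemma many_pairs_path:
  assumes "finite V" "symp R" "irreflp R" "2 * d * card V < card {(x, y) \<in> V \<times> V. R x y}"
  obtains T where "T \<subseteq> V" "T \<noteq> {}" "\<And>x. x \<in> T \<Longrightarrow> \<exists>y\<in>T. R x y"
    and "\<And>x. x \<in> T \<Longrightarrow> \<exists>xs. length xs = d + 2 \<and> distinct xs \<and> set xs \<subseteq> T \<and> successively R xs \<and> last xs = x"
proof -
  have "\<exists>T. T \<subseteq> V \<and> T \<noteq> {} \<and> (\<forall>x\<in>T. Suc d \<le> card {y \<in> T. R x y})"
  proof (rule ccontr)
    assume "\<not> ?thesis"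
    then have "\<exists>x\<in>T. card {y \<in> T. R x y} \<le> d" if "T \<subseteq> V" "T \<noteq> {}" for T
      using that by (auto simp: not_less_eq_eq)
    then have "card {(x, y) \<in> V \<times> V. R x y} \<le> 2 * d * card V"
      by (rule card_pairs_degenerate[OF assms(1,2)])
    then show False using assms(4) by simp
  qed
  then obtain T where T: "T \<subseteq> V" "T \<noteq> {}" "\<And>x. x \<in> T \<Longrightarrow> Suc d \<le> card {y \<in> T. R x y}" by blast
  have "finite T" using T(1) assms(1) finite_subset by blast
  show ?thesis
  proof
    show "\<exists>y\<in>T. R x y" if "x \<in> T" for x
    proof (rule ccontr)
      assume "\<not> ?thesis"
      then have "{y \<in> T. R x y} = {}" by blast
      then have "card {y \<in> T. R x y} = 0" by (metis card.empty)
      then show False using T(3)[OF that] by linarith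
    qed
    show "\<exists>xs. length xs = d + 2 \<and> distinct xs \<and> set xs \<subseteq> T \<and> successively R xs \<and> last xs = x" if "x \<in> T" for x
      using min_degree_path[OF \<open>finite T\<close> that assms(2,3) T(3)] by simp
  qed (use T in auto)
qed

lemma alternating_ends:
  fixes P :: "'a \<Rightarrow> bool"
  assumes "successively (\<lambda>x y. P x \<noteq> P y) xs" "odd (length xs)"
  shows "P (hd xs) = P (last xs)"
proof -
  have "P (hd xs) = (P (last xs) = odd (length xs))" if "xs \<noteq> []"
    using assms(1) that
    by (induction xs rule: induct_list012) auto
  moreover have "xs \<noteq> []" using assms(2) by auto
  ultimately show ?thesis using assms(2) by simp
qed

section \<open>Matchings inside the clique and the bound for one even cycle\<close>

locale even_cycle_free = clique_graph +
  fixes k :: nat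
  assumes k_ge: "k \<ge> 3" and cf: "cycle_free (2 * k)"
begin

lemma symp_adj: "symp (\<sim>)"
  by (auto intro: sympI adj_sym)

lemma irreflp_adj: "irreflp (\<sim>)"
  by (auto intro: irreflpI dest: adj_neq)

text \<open>Double counting of ordered adjacent pairs in \<open>A \<union> B\<close>: attachment
  yields one for each ordered pair of distinct edges of \<open>F\<close>, so at least
  \<open>card F * (card F - 1)\<close>, while the absence of a \<open>2k\<close>-cycle through
  \<open>u\<close> allows only linearly many.\<close>

lemma card_fan_le:
  assumes F: "F \<subseteq> S" "pairwise disjnt F" "u \<notin> \<Union>F" and fan: "\<And>f. f \<in> F \<Longrightarrow> \<exists>a\<in>f. u \<sim> a"
  shows "card F \<le> 16 * k - 27"
proof -
  obtain \<alpha> where \<alpha>: "\<And>f. f \<in> F \<Longrightarrow> \<alpha> f \<in> f \<and> u \<sim> \<alpha> f" using fan by metis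
  have "\<exists>b. f = {\<alpha> f, b} \<and> \<alpha> f \<sim> b" if "f \<in> F" for f
    using S_edge_atE[of f "\<alpha> f"] \<alpha>[OF that] that F(1) by blast
  then obtain \<beta> where \<beta>: "\<And>f. f \<in> F \<Longrightarrow> f = {\<alpha> f, \<beta> f} \<and> \<alpha> f \<sim> \<beta> f" by metis
  have finF: "finite F" using F(1) finite_S finite_subset by blast
  have uniq: "f = g" if "f \<in> F" "g \<in> F" "x \<in> f" "x \<in> g" for f g x
    using F(2) that by (auto simp: pairwise_def disjnt_def)
  define A where "A = \<alpha> ` F"
  define B where "B = \<beta> ` F"
  have mem: "\<alpha> f \<in> f" "\<beta> f \<in> f" if "f \<in> F" for f using \<alpha> \<beta> that by auto
  have "inj_on \<alpha> F" "inj_on \<beta> F" using uniq mem by (metis inj_onI)+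
  then have card: "card A = card F" "card B = card F" by (auto simp: A_def B_def card_image)
  have fin: "finite A" "finite B" using finF by (auto simp: A_def B_def)
  have "\<alpha> f \<noteq> \<beta> g" if "f \<in> F" "g \<in> F" for f g
    using uniq[of f g "\<alpha> f"] mem[OF that(1)] mem[OF that(2)] \<beta>[OF that(1)] adj_neq that by metis
  then have AB: "A \<inter> B = {}" by (auto simp: A_def B_def)
  have uAB: "u \<notin> A" "u \<notin> B" using F(3) mem by (auto simp: A_def B_def)
  have uA: "u \<sim> a" if "a \<in> A" for a using that \<alpha> by (auto simp: A_def)
  \<comment> \<open>Writing \<open>k = j + 3\<close> avoids truncated subtraction:
    \<open>2 * j + 5\<close> is \<open>2k - 1\<close> and \<open>2 * j + 3\<close> is
    \<open>2k - 3\<close>.\<close>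
  obtain j where j: "k = j + 3" using k_ge le_Suc_ex[of 3 k] by (auto simp: add.commute)
  \<comment> \<open>With \<open>u\<close>, a path on \<open>2k - 1\<close> vertices from \<open>A\<close> to \<open>A\<close> closes to a \<open>2k\<close>-cycle.\<close>
  have pathA: False if "length xs = 2 * j + 5" "distinct xs" "successively (\<sim>) xs"
    "set xs \<subseteq> A \<union> B" "hd xs \<in> A" "last xs \<in> A" for xs
  proof -
    have "xs \<noteq> []" using that(1) by auto
    then show False
      using cycle_freeD[OF cf, of "u # xs"] that uA adj_sym uAB j by (auto simp: successively_Cons)
  qed
  \<comment> \<open>A path on \<open>2k - 3\<close> vertices inside \<open>B\<close> is first prolonged by the partners of its ends.\<close>
  have pathB: False if xs: "length xs = 2 * j + 3" "distinct xs" "successively (\<sim>) xs" "set xs \<subseteq> B" for xs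
  proof -
    have ne: "xs \<noteq> []" using xs(1) by auto
    then have "hd xs \<in> B" "last xs \<in> B" using xs(4) by auto
    then obtain f g where fg: "f \<in> F" "g \<in> F" "hd xs = \<beta> f" "last xs = \<beta> g" by (auto simp: B_def)
    have "hd xs \<noteq> last xs" using xs(1,2) by (cases xs) auto
    then have "\<alpha> f \<noteq> \<alpha> g" using fg \<open>inj_on \<alpha> F\<close> by (metis inj_onD)
    moreover have A: "\<alpha> f \<in> A" "\<alpha> g \<in> A" using fg by (auto simp: A_def)
    moreover have "\<alpha> f \<sim> hd xs" "last xs \<sim> \<alpha> g" using fg \<beta> adj_sym by auto
    moreover have "u \<noteq> \<alpha> f" "u \<noteq> \<alpha> g" "u \<notin> set xs" "\<alpha> f \<notin> set xs" "\<alpha> g \<notin> set xs"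
      using A uAB AB xs(4) by auto
    ultimately show False
      using cycle_freeD[OF cf, of "u # \<alpha> f # xs @ [\<alpha> g]"] xs ne uA adj_sym j
      by (auto simp: successively_Cons successively_append_iff)
  qed
  \<comment> \<open>The parameter \<open>d\<close> is two less than the number of vertices on the
    forbidden path: \<open>2 * j + 3\<close> here and between \<open>A\<close> and \<open>B\<close>,
    \<open>2 * j + 1\<close> inside \<open>B\<close>.\<close>
  have NA: "card {(x, y) \<in> A \<times> A. x \<sim> y} \<le> 2 * (2 * j + 3) * card A"
  proof (rule ccontr)
    assume "\<not> ?thesis"
    then have "2 * (2 * j + 3) * card A < card {(x, y) \<in> A \<times> A. x \<sim> y}" by (simp only: not_le)
    from fin(1) symp_adj irreflp_adj this show False
    proof (rule many_pairs_path)
      fix T assume T: "T \<subseteq> A" "T \<noteq> {}" and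
        path: "\<And>x. x \<in> T \<Longrightarrow> \<exists>xs. length xs = 2 * j + 3 + 2 \<and> distinct xs \<and> set xs \<subseteq> T \<and> successively (\<sim>) xs \<and> last xs = x"
      then obtain xs where xs: "length xs = 2 * j + 3 + 2" "distinct xs" "set xs \<subseteq> T" "successively (\<sim>) xs"
        by blast
      then have "xs \<noteq> []" by auto
      then have "hd xs \<in> A" "last xs \<in> A" using hd_in_set last_in_set xs(3) T(1) by blast+
      then show False using pathA[of xs] xs T(1) by auto
    qed
  qed
  have NB: "card {(x, y) \<in> B \<times> B. x \<sim> y} \<le> 2 * (2 * j + 1) * card B"
  proof (rule ccontr)
    assume "\<not> ?thesis"
    then have "2 * (2 * j + 1) * card B < card {(x, y) \<in> B \<times> B. x \<sim> y}" by (simp only: not_le)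
    from fin(2) symp_adj irreflp_adj this show False
    proof (rule many_pairs_path)
      fix T assume T: "T \<subseteq> B" "T \<noteq> {}" and
        path: "\<And>x. x \<in> T \<Longrightarrow> \<exists>xs. length xs = 2 * j + 1 + 2 \<and> distinct xs \<and> set xs \<subseteq> T \<and> successively (\<sim>) xs \<and> last xs = x"
      then obtain xs where "length xs = 2 * j + 1 + 2" "distinct xs" "set xs \<subseteq> T" "successively (\<sim>) xs"
        by blast
      then show False using pathB[of xs] T(1) by auto
    qed
  qed
  define R where "R x y \<longleftrightarrow> x \<sim> y \<and> (x \<in> A) \<noteq> (y \<in> A)" for x y
  have R: "symp R" "irreflp R"
    using adj_sym by (auto simp: R_def intro!: sympI irreflpI)
  have NAB: "card {(x, y) \<in> (A \<union> B) \<times> (A \<union> B). R x y} \<le> 2 * (2 * j + 3) * card (A \<union> B)"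
  proof (rule ccontr)
    assume "\<not> ?thesis"
    then have "2 * (2 * j + 3) * card (A \<union> B) < card {(x, y) \<in> (A \<union> B) \<times> (A \<union> B). R x y}"
      by (simp only: not_le)
    from finite_UnI[OF fin] R this show False
    proof (rule many_pairs_path)
      fix T assume T: "T \<subseteq> A \<union> B" "T \<noteq> {}" "\<And>x. x \<in> T \<Longrightarrow> \<exists>y\<in>T. R x y" and
        path: "\<And>x. x \<in> T \<Longrightarrow> \<exists>xs. length xs = 2 * j + 3 + 2 \<and> distinct xs \<and> set xs \<subseteq> T \<and> successively R xs \<and> last xs = x"
      \<comment> \<open>Every vertex of \<open>T\<close> has a neighbour on the other side, so
        \<open>T\<close> meets \<open>A\<close>. The path ending in \<open>a\<close> has an odd
        number of vertices and alternates, so it also starts in \<open>A\<close>.\<close>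
      obtain a where a: "a \<in> T" "a \<in> A" using T(2,3) unfolding R_def by blast
      then obtain xs where xs: "length xs = 2 * j + 3 + 2" "distinct xs" "set xs \<subseteq> T"
        "successively R xs" "last xs = a"
        using path by blast
      have alt: "successively (\<lambda>x y. (x \<in> A) \<noteq> (y \<in> A)) xs" and succ: "successively (\<sim>) xs"
        using xs(4) by (auto simp: R_def elim!: successively_mono)
      have "hd xs \<in> A" using alternating_ends[OF alt] xs(1,5) a by auto
      then show False using pathA[of xs] xs succ a T(1) by auto
    qed
  qed
  have card_AB: "card (A \<union> B) = 2 * card F" using card fin AB by (simp add: card_Un_disjoint)
  define E where "E = {(x, y) \<in> (A \<union> B) \<times> (A \<union> B). x \<sim> y}"
  have finE: "finite E" using fin by (auto simp: E_def intro: finite_subset[of _ "(A \<union> B) \<times> (A \<union> B)"])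
  have "E \<subseteq> {(x, y) \<in> A \<times> A. x \<sim> y} \<union> ({(x, y) \<in> B \<times> B. x \<sim> y} \<union> {(x, y) \<in> (A \<union> B) \<times> (A \<union> B). R x y})"
    using AB by (auto simp: E_def R_def)
  then have "card E \<le> card ({(x, y) \<in> A \<times> A. x \<sim> y} \<union> ({(x, y) \<in> B \<times> B. x \<sim> y} \<union> {(x, y) \<in> (A \<union> B) \<times> (A \<union> B). R x y}))"
    using fin by (intro card_mono) (auto intro: finite_subset[of _ "(A \<union> B) \<times> (A \<union> B)"])
  also have "\<dots> \<le> card {(x, y) \<in> A \<times> A. x \<sim> y} + (card {(x, y) \<in> B \<times> B. x \<sim> y} + card {(x, y) \<in> (A \<union> B) \<times> (A \<union> B). R x y})"
    by (meson card_Un_le add_left_mono order_trans)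
  also have "\<dots> \<le> 2 * (2 * j + 3) * card F + (2 * (2 * j + 1) * card F + 2 * (2 * j + 3) * (2 * card F))"
    using NA NB NAB unfolding card card_AB by (intro add_mono)
  also have "\<dots> = (16 * j + 20) * card F" by (simp add: algebra_simps)
  finally have E_le: "card E \<le> (16 * j + 20) * card F" .
  \<comment> \<open>Sending each vertex to its edge of \<open>F\<close> maps \<open>E\<close> onto a
    set that contains all ordered pairs of distinct edges of \<open>F\<close>.\<close>
  define own where "own x = (THE f. f \<in> F \<and> x \<in> f)" for x
  have own: "own x = f" if "f \<in> F" "x \<in> f" for x f
    unfolding own_def using that uniq by (intro the_equality) auto
  have FAB: "x \<in> A \<union> B" if "f \<in> F" "x \<in> f" for f x
    using that \<beta>[OF that(1)] by (auto simp: A_def B_def)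
  let ?diag = "(\<lambda>f. (f, f)) ` F"
  have "F \<times> F - ?diag \<subseteq> map_prod own own ` E"
  proof
    fix p assume "p \<in> F \<times> F - ?diag"
    then obtain f g where fg: "p = (f, g)" "f \<in> F" "g \<in> F" "f \<noteq> g" by auto
    then have "f \<inter> g = {}" using F(2) by (auto simp: pairwise_def disjnt_def)
    then obtain x y where xy: "x \<in> f" "y \<in> g" "x \<sim> y" using attached[of f g] fg F(1) by blast
    then have "(x, y) \<in> E" using FAB fg by (auto simp: E_def)
    moreover have "p = map_prod own own (x, y)" using own fg xy by simp
    ultimately show "p \<in> map_prod own own ` E" by blast
  qed
  then have "card (F \<times> F - ?diag) \<le> card (map_prod own own ` E)" using finE by (intro card_mono) auto
  also have "\<dots> \<le> card E" using finE by (rule card_image_le)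
  finally have "card (F \<times> F - ?diag) \<le> card E" .
  moreover have "card ?diag = card F" by (intro card_image) (auto simp: inj_on_def)
  moreover have "card (F \<times> F - ?diag) = card F * card F - card ?diag"
    using finF by (subst card_Diff_subset) (auto simp: card_cartesian_product)
  ultimately have "card F * card F \<le> (16 * j + 21) * card F" using E_le by (simp add: algebra_simps)
  then have "card F \<le> 16 * j + 21" by (cases "card F = 0") auto
  then show ?thesis using j by simp
qed

text \<open>All edges of \<open>M\<close> other than a fixed \<open>{u, v}\<close> have an end
  adjacent to \<open>u\<close> or to \<open>v\<close>; they form two fans, and 1 + 2(16k - 27) = 32k
  - 53.\<close>

lemma card_matching_le:
  assumes M: "M \<subseteq> S" "pairwise disjnt M"
  shows "card M \<le> 32 * k - 53"
proof (cases "M = {}")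
  case False
  then obtain e where e: "e \<in> M" by blast
  then obtain u v where uv: "e = {u, v}" using S_edgeE M(1) by blast
  define fan where "fan w = {f \<in> M - {e}. \<exists>a\<in>f. w \<sim> a}" for w
  have disj: "e \<inter> f = {}" if "f \<in> M - {e}" for f
    using M(2) e that by (auto simp: pairwise_def disjnt_def)
  have le: "card (fan w) \<le> 16 * k - 27" if "w \<in> e" for w
  proof (rule card_fan_le)
    show "fan w \<subseteq> S" "pairwise disjnt (fan w)"
      using M by (auto simp: fan_def pairwise_def)
    show "w \<notin> \<Union> (fan w)" using disj that by (auto simp: fan_def)
  qed (auto simp: fan_def)
  have finM: "finite M" using M(1) finite_S finite_subset by blast
  have "M \<subseteq> insert e (fan u \<union> fan v)"
  proof
    fix f assume f: "f \<in> M"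
    show "f \<in> insert e (fan u \<union> fan v)"
    proof (cases "f = e")
      case False
      then obtain x y where "x \<in> e" "y \<in> f" "x \<sim> y"
        using attached[of e f] disj[of f] f e M(1) by blast
      then show ?thesis using False f uv by (auto simp: fan_def)
    qed simp
  qed
  then have "card M \<le> card (insert e (fan u \<union> fan v))"
    using finM by (intro card_mono) (auto simp: fan_def)
  also have "\<dots> \<le> Suc (card (fan u \<union> fan v))" by (rule card_insert_le_m1) auto
  also have "\<dots> \<le> Suc (card (fan u) + card (fan v))" using card_Un_le by auto
  finally show ?thesis using le[of u] le[of v] uv k_ge by simp
qed simp

text \<open>When an edge joins a matching of \<open>m\<close> edges, its attachments to them are
  \<open>m\<close> edges counted before, and the new edge itself would be counted twice. The savings
  \<open>m + 1\<close> add up to a triangular number, and doubling avoids the fraction.\<close>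

lemma card_inc_matching:
  assumes "finite M" "M \<subseteq> S" "pairwise disjnt M"
  shows "2 * card (inc (\<Union>M)) + card M * card M + card M \<le> 4 * card M * D"
  using assms
proof (induction M)
  case empty
  then show ?case by (simp add: card_inc_empty)
next
  case (insert e M)
  let ?X = "\<Union>M"
  have IH: "2 * card (inc ?X) + card M * card M + card M \<le> 4 * card M * D"
    using insert by (auto simp: pairwise_insert)
  obtain y z where yz: "e = {y, z}" "y \<sim> z" using insert.prems(1) by (auto elim: S_edgeE)
  have disj: "e \<inter> f = {}" if "f \<in> M" for f
    using insert.prems(2) insert.hyps(2) that by (auto simp: pairwise_def disjnt_def)
  have finX: "finite ?X"
    using insert.hyps(1) insert.prems(1) by (auto elim!: S_edgeE)
  have yzX: "y \<notin> ?X" "z \<notin> insert y ?X" using disj yz adj_neq by auto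
  let ?Y = "{x \<in> ?X. y \<sim> x}" and ?Z = "{x \<in> ?X. z \<sim> x}"
  have "\<exists>c\<in>f. c \<in> ?Y \<union> ?Z" if f: "f \<in> M" for f
  proof -
    obtain p q where "p \<in> e" "q \<in> f" "p \<sim> q"
      using attached[of e f] disj[OF f] f insert.prems(1) by blast
    then show ?thesis using f yz by auto
  qed
  \<comment> \<open>One attached end per edge of \<open>M\<close>: these are distinct because the
    edges are disjoint, so \<open>y\<close> and \<open>z\<close> together send at least
    \<open>card M\<close> edges to \<open>\<Union>M\<close>.\<close>
  then obtain c where c: "\<And>f. f \<in> M \<Longrightarrow> c f \<in> f \<and> c f \<in> ?Y \<union> ?Z" by metis
  have "inj_on c M"
  proof (rule inj_onI)
    fix f g assume "f \<in> M" "g \<in> M" "c f = c g"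
    then have "c f \<in> f \<inter> g" using c[of f] c[of g] by auto
    then show "f = g"
      using insert.prems(2) \<open>f \<in> M\<close> \<open>g \<in> M\<close> unfolding pairwise_def disjnt_def by blast
  qed
  then have "card M = card (c ` M)" by (simp add: card_image)
  also have "\<dots> \<le> card (?Y \<union> ?Z)"
  proof (rule card_mono)
    show "finite (?Y \<union> ?Z)" by (rule finite_subset[OF _ finX]) blast
    show "c ` M \<subseteq> ?Y \<union> ?Z" using c by blast
  qed
  also have "\<dots> \<le> card ?Y + card ?Z" by (rule card_Un_le)
  finally have YZ: "card M \<le> card ?Y + card ?Z" .
  have "card (inc (insert y ?X)) + card ?Y \<le> card (inc ?X) + D"
    using finX yzX by (intro card_inc_insert) auto
  moreover have "card (inc (insert z (insert y ?X))) + card (insert y ?Z) \<le> card (inc (insert y ?X)) + D"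
    using finX yzX yz(2) adj_sym by (intro card_inc_insert) auto
  moreover have "finite ?Z" by (rule finite_subset[OF _ finX]) blast
  then have "card (insert y ?Z) = Suc (card ?Z)" using yzX by (intro card_insert_disjoint) blast+
  moreover have "\<Union>(insert e M) = insert z (insert y ?X)" using yz by auto
  ultimately have step: "card (inc (\<Union>(insert e M))) + card M + 1 \<le> card (inc ?X) + 2 * D"
    using YZ by simp
  have cardM: "card (insert e M) = Suc (card M)" using insert.hyps by simp
  show ?case unfolding cardM using step IH by (simp add: algebra_simps)
qed

text \<open>The vertices of a maximum matching \<open>M\<close> in \<open>S\<close> meet every edge
  of \<open>S\<close>. If \<open>M\<close> has at least three edges, the savings leave at most
  \<open>2 * card M * (D - 1)\<close>, where \<open>2 * card M\<close> is at most
  \<open>10 * k\<^sup>2\<close>. If it has fewer, \<open>card S\<close> is at most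
  \<open>4 * D\<close>, hence at most \<open>8 * (D - 1)\<close> because
  \<open>D \<ge> 2\<close>.\<close>

lemma card_S_le:
  assumes "D \<ge> 2"
  shows "card S + 10 * k\<^sup>2 \<le> 10 * k\<^sup>2 * D"
proof -
  define \<M> where "\<M> = {M. M \<subseteq> S \<and> pairwise disjnt M}"
  have "finite \<M>" using finite_S by (auto simp: \<M>_def)
  moreover have "{} \<in> \<M>" by (auto simp: \<M>_def)
  ultimately have "Max (card ` \<M>) \<in> card ` \<M>" and Max: "\<And>M. M \<in> \<M> \<Longrightarrow> card M \<le> Max (card ` \<M>)"
    by (auto intro!: Max_in)
  then obtain M where M: "M \<subseteq> S" "pairwise disjnt M" "card M = Max (card ` \<M>)" by (auto simp: \<M>_def)
  have finM: "finite M" using M(1) finite_S finite_subset by blast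
  have "e \<inter> \<Union>M \<noteq> {}" if e: "e \<in> S" for e
  proof
    assume disj: "e \<inter> \<Union>M = {}"
    have "e \<noteq> {}" using e by (auto elim: S_edgeE)
    then have "e \<notin> M" using disj by auto
    moreover have "insert e M \<in> \<M>"
      using M e disj by (auto simp: \<M>_def pairwise_insert disjnt_def)
    then have "card (insert e M) \<le> card M" using Max M(3) by metis
    ultimately show False using finM by simp
  qed
  then have "card S \<le> card (inc (\<Union>M))" by (rule card_S_le_inc)
  then have S: "2 * card S + card M * card M + card M \<le> 4 * card M * D"
    using card_inc_matching[OF finM M(1,2)] by linarith
  show ?thesis
  proof (cases "card M \<ge> 3")
    case True
    have "3 * card M \<le> card M * card M" using True by simp
    then have 1: "card S + 2 * card M \<le> 2 * card M * D" using S by linarith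
    have "2 * card M \<le> 10 * k\<^sup>2"
    proof -
      have "int (2 * card M) \<le> 64 * int k - 106" using card_matching_le[OF M(1,2)] k_ge by linarith
      \<comment> \<open>The quadratic 10k^2 - 64k + 96 = (k - 4)(10k - 24) is nonnegative from 4 on
        but negative at 3, where the inequality reads 86 \<le> 90.\<close>
      also have "\<dots> \<le> 10 * (int k)\<^sup>2"
      proof (cases "k \<ge> 4")
        case True
        then have "0 \<le> (int k - 4) * (10 * int k - 24)" by (intro mult_nonneg_nonneg) auto
        then show ?thesis by (simp add: algebra_simps power2_eq_square)
      next
        case False
        then have "k = 3" using k_ge by simp
        then show ?thesis by simp
      qed
      finally show ?thesis by (metis of_nat_le_iff of_nat_mult of_nat_numeral of_nat_power)
    qed
    then obtain i where i: "10 * k\<^sup>2 = 2 * card M + i" using le_Suc_ex by blast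
    have "i \<le> i * D" using assms by (cases D) auto
    moreover have "10 * k\<^sup>2 * D = 2 * card M * D + i * D" unfolding i by (rule add_mult_distrib)
    ultimately show ?thesis using 1 i by linarith
  next
    case False
    then have "4 * card M * D \<le> 8 * D" by (intro mult_right_mono) auto
    then have "card S \<le> 4 * D" using S by linarith
    moreover have "3\<^sup>2 \<le> k\<^sup>2" using k_ge by (intro power_mono) auto
    then obtain i where i: "10 * k\<^sup>2 = 8 + i" using le_Suc_ex[of 8 "10 * k\<^sup>2"] by auto
    have "i \<le> i * D" using assms by (cases D) auto
    moreover have "10 * k\<^sup>2 * D = 8 * D + i * D" unfolding i by (rule add_mult_distrib)
    ultimately show ?thesis using assms i by linarith
  qed
qed

end

section \<open>Graphs without three consecutive cycle lengths\<close>

context clique_graph begin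

text \<open>Only the interior \<open>Q\<close> is kept as a list, since it is \<open>Q\<close> that
  serves as a cover of \<open>S\<close> and whose length is compared with \<open>k\<close>; the
  whole path has \<open>length Q + 2\<close> vertices.\<close>

definition spath :: "'a \<Rightarrow> 'a list \<Rightarrow> 'a \<Rightarrow> bool" where
  "spath a Q d \<longleftrightarrow> Q \<noteq> [] \<and> distinct (a # Q @ [d]) \<and> successively (\<sim>) Q \<and>
     {a, hd Q} \<in> S \<and> {last Q, d} \<in> S"

lemma spath_rev: "spath a Q d \<Longrightarrow> spath d (rev Q) a"
  unfolding spath_def
  by (auto simp: hd_rev last_rev insert_commute adj_sym intro: successively_mono)

lemma spath_adj:
  assumes "spath a Q d"
  shows "a \<sim> hd Q" "last Q \<sim> d"
  using assms S_adj by (auto simp: spath_def)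

lemma spath_Cons:
  assumes "spath a Q d" "{w, a} \<in> S" "w \<notin> set Q" "w \<noteq> d"
  shows "spath w (a # Q) d"
  using assms spath_adj[OF assms(1)] S_adj[OF assms(2)] adj_neq
  by (auto simp: spath_def successively_Cons)

text \<open>The new end edge \<open>{z, y}\<close> replaces the old one: \<open>a\<close> is dropped
  and the interior grows by one.\<close>

lemma spath_extend1:
  assumes "spath a Q d" "{z, y} \<in> S" "{z, y} \<inter> set (a # Q @ [d]) = {}" "y \<sim> hd Q"
  shows "spath z (y # Q) d"
  using assms S_adj[OF assms(2)] adj_neq
  by (auto simp: spath_def successively_Cons)

text \<open>Here \<open>a\<close> is kept and becomes interior together with \<open>y\<close>, so
  the interior grows by two.\<close>

lemma spath_extend2:
  assumes "spath a Q d" "{z, y} \<in> S" "{z, y} \<inter> set (a # Q @ [d]) = {}" "y \<sim> a"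
  shows "spath z (y # a # Q) d"
  using assms spath_adj[OF assms(1)] S_adj[OF assms(2)] adj_neq
  by (auto simp: spath_def successively_Cons)

lemma spath_attachedE:
  assumes "spath a Q d" "f \<in> S" "f \<inter> set (a # Q @ [d]) = {}"
  obtains (near) y z where "f = {z, y}" "y \<sim> hd Q" | (far) y z where "f = {z, y}" "y \<sim> a"
proof -
  have "{a, hd Q} \<in> S" "hd Q \<in> set Q" using assms(1) by (auto simp: spath_def)
  then obtain x y where xy: "x \<in> {a, hd Q}" "y \<in> f" "x \<sim> y"
    using attached[of "{a, hd Q}" f] assms(2,3) by auto
  obtain z where "f = {y, z}" using S_edge_atE[OF assms(2) xy(2)] by blast
  then show ?thesis using xy near[of z y] far[of z y] adj_sym by (auto simp: insert_commute)
qed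

end

locale three_cycle_free = clique_graph +
  fixes k :: nat
  assumes k_ge: "k \<ge> 2"
    and cf: "cycle_free (2 * k)" "cycle_free (2 * k + 1)" "cycle_free (2 * k + 2)"
begin

lemma no_cycle:
  assumes "distinct xs" "successively (\<sim>) xs" "last xs \<sim> hd xs"
    and "length xs \<in> {2 * k, 2 * k + 1, 2 * k + 2}"
  shows False
  using cycle_freeD[OF cf(1) assms(1-3)] cycle_freeD[OF cf(2) assms(1-3)]
    cycle_freeD[OF cf(3) assms(1-3)] assms(4) k_ge by auto

text \<open>The four possible attachments of the two end edges close cycles on
  \<open>length Q\<close>, \<open>length Q + 1\<close> (twice) or \<open>length Q + 2\<close>
  vertices. All of these are forbidden if \<open>length Q = 2 * k\<close>; for
  \<open>2 * k - 1\<close> only the shortest is allowed.\<close>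

lemma spath_ends:
  assumes P: "spath a Q d" and Q: "length Q \<in> {2 * k - 1, 2 * k}"
  shows "length Q = 2 * k - 1 \<and> last Q \<sim> hd Q \<and> \<not> d \<sim> a"
proof -
  have Qne: "Q \<noteq> []" and dist: "distinct (a # Q @ [d])" and succ: "successively (\<sim>) Q"
    and S: "{a, hd Q} \<in> S" "{last Q, d} \<in> S"
    using P by (auto simp: spath_def)
  note adj = spath_adj[OF P]
  have 1: "\<not> d \<sim> a"
    using no_cycle[of "a # Q @ [d]"] dist succ Q Qne adj k_ge
    by (auto simp: successively_Cons successively_append_iff)
  have 2: "\<not> last Q \<sim> a"
    using no_cycle[of "a # Q"] dist succ Q Qne adj k_ge
    by (auto simp: successively_Cons)
  have 3: "\<not> d \<sim> hd Q"
    using no_cycle[of "Q @ [d]"] dist succ Q Qne adj k_ge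
    by (auto simp: successively_append_iff)
  have "length Q \<ge> 2" using Q k_ge by auto
  then have "hd Q \<noteq> last Q"
    using dist by (cases Q) auto
  moreover have "hd Q \<in> set Q" "last Q \<in> set Q" using Qne by auto
  ultimately have "{a, hd Q} \<inter> {last Q, d} = {}" using dist by auto
  then obtain x y where "x \<in> {a, hd Q}" "y \<in> {last Q, d}" "x \<sim> y"
    using attached[OF S] by blast
  then have "last Q \<sim> hd Q" using 1 2 3 adj_sym by auto
  moreover have "length Q \<noteq> 2 * k"
    using no_cycle[of Q] dist succ \<open>last Q \<sim> hd Q\<close> by auto
  ultimately show ?thesis using 1 Q by auto
qed

lemma spath_length_neq: "spath a Q d \<Longrightarrow> length Q \<noteq> 2 * k"
  using spath_ends[of a Q d] k_ge by auto

text \<open>Otherwise \<open>f\<close> could be put in front of the path, whose interior would then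
  have \<open>2 * k\<close> vertices.\<close>

lemma end_edge_meets:
  assumes "spath a Q d" "length Q = 2 * k - 1" "f \<in> S" "a \<in> f"
  shows "f \<inter> set Q \<noteq> {}"
proof
  assume f: "f \<inter> set Q = {}"
  obtain w where w: "f = {a, w}" "a \<sim> w" using S_edge_atE assms(3,4) by blast
  have "w \<noteq> d" using spath_ends[OF assms(1)] assms(2) w adj_sym by auto
  then have "spath w (a # Q) d" using spath_Cons[OF assms(1)] assms(3) w f by (auto simp: insert_commute)
  then show False using spath_length_neq assms(2) k_ge by fastforce
qed

text \<open>Attachment of \<open>f\<close> to an inner vertex of an end edge would lengthen the
  interior to \<open>2 * k\<close>, so \<open>f\<close> is attached to \<open>a\<close> and to
  \<open>d\<close>. One vertex adjacent to both would close a cycle on \<open>2 * k + 2\<close>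
  vertices, so different ends are used.\<close>

lemma long_spath_attachedE:
  assumes "spath a Q d" "length Q = 2 * k - 1" "f \<in> S" "f \<inter> set Q = {}"
  obtains y z where "f = {z, y}" "y \<sim> a" "z \<sim> d" "f \<inter> set (a # Q @ [d]) = {}"
proof -
  note R = spath_rev[OF assms(1)]
  have disj: "f \<inter> set (a # Q @ [d]) = {}"
    using end_edge_meets[OF assms(1-3)] end_edge_meets[OF R _ assms(3)] assms(2,4) by auto
  have Qne: "Q \<noteq> []" and dist: "distinct (a # Q @ [d])" and succ: "successively (\<sim>) Q"
    using assms(1) by (auto simp: spath_def)
  from assms(1,3) disj show ?thesis
  proof (cases rule: spath_attachedE)
    case (near y z)
    then have "spath z (y # Q) d" using spath_extend1[OF assms(1)] assms(3) disj by blast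
    then show ?thesis using spath_length_neq assms(2) k_ge by fastforce
  next
    case (far y z)
    have disj': "f \<inter> set (d # rev Q @ [a]) = {}" using disj by auto
    with R assms(3) show ?thesis
    proof (cases rule: spath_attachedE)
      case (near y' z')
      then have "spath z' (y' # rev Q) a" using spath_extend1[OF R] assms(3) disj' by blast
      then show ?thesis using spath_length_neq assms(2) k_ge by fastforce
    next
      case far': (far y' z')
      have "y \<notin> set (a # Q @ [d])" using far disj by auto
      then have "\<not> d \<sim> y"
        using no_cycle[of "y # a # Q @ [d]"] dist succ Qne spath_adj[OF assms(1)] assms(2) k_ge far
        by (auto simp: successively_Cons successively_append_iff)
      then have "y' \<noteq> y" using far' adj_sym by auto
      then have "y' = z" using far far' by auto
      then show ?thesis using that far far' disj by blast
    qed
  qed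
qed

text \<open>An edge \<open>{q, p}\<close> that misses the interior can be reached from
  \<open>d\<close>. The path \<open>w\<close>, \<open>Q\<close>, \<open>d\<close>, \<open>q\<close>,
  \<open>p\<close> then has end edges in \<open>S\<close> and an interior of \<open>2 * k\<close>
  vertices, which is impossible.\<close>

lemma long_spath_covers:
  assumes P: "spath a (y # Q) d" and Q: "length Q = 2 * k - 2"
    and w: "{w, hd Q} \<in> S" "w \<notin> set Q" "w \<noteq> d"
    and f: "f \<in> S"
  shows "f \<inter> set (y # Q) \<noteq> {}"
proof
  assume "f \<inter> set (y # Q) = {}"
  moreover have len: "length (y # Q) = 2 * k - 1" using Q k_ge by auto
  ultimately obtain p q where pq: "f = {q, p}" "p \<sim> a" "q \<sim> d"
    and disj: "f \<inter> set (a # (y # Q) @ [d]) = {}"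
    using long_spath_attachedE[OF P _ f] by blast
  have Qne: "Q \<noteq> []" and lQ: "Suc (Suc (length Q)) = 2 * k" using Q k_ge by auto
  have qp: "q \<sim> p" using f pq S_adj by auto
  have R: "successively (\<sim>) (Q @ [d, q])" "distinct (Q @ [d, q])" "p \<notin> set (Q @ [d, q])"
    using P disj Qne pq adj_sym qp adj_neq
    by (auto simp: spath_def successively_Cons successively_append_iff S_adj)
  show False
  proof (cases "w = p \<or> w = q")
    \<comment> \<open>If \<open>w\<close> lies on \<open>f\<close>, then \<open>hd Q\<close> is
      adjacent to \<open>q\<close> or \<open>p\<close>, closing a cycle on \<open>2 * k\<close> or
      \<open>2 * k + 1\<close> vertices.\<close>
    case True
    have "\<not> q \<sim> hd Q"
      using no_cycle[of "Q @ [d, q]"] R Qne lQ by auto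
    moreover have "\<not> p \<sim> hd Q"
      using no_cycle[of "Q @ [d, q, p]"] R Qne lQ qp by (auto simp: successively_append_iff)
    ultimately show False using True S_adj[OF w(1)] by auto
  next
    case False
    then have "spath w (Q @ [d, q]) p"
      using R w Qne f pq by (auto simp: spath_def)
    then show False using spath_length_neq Q k_ge by fastforce
  qed
qed

lemma card_S_by_inc_path:
  assumes "spath a Q d" "\<And>f. f \<in> S \<Longrightarrow> f \<inter> set Q \<noteq> {} \<or> f = {a, d}"
  shows "card S + length Q \<le> length Q * D + 2"
proof -
  have "S \<subseteq> insert {a, d} (inc (set Q))" using assms(2) S_edges by (auto simp: inc_def)
  then have "card S \<le> card (insert {a, d} (inc (set Q)))"
    by (intro card_mono) (auto simp: finite_inc)
  also have "\<dots> \<le> Suc (card (inc (set Q)))" by (rule card_insert_le_m1) auto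
  finally show ?thesis using card_inc_path[of Q] assms(1) by (auto simp: spath_def)
qed

text \<open>An edge sharing an end with the path, or attached to an inner vertex of an end edge,
  adds one interior vertex. Attachment to an outer end adds two, which is too many only if
  \<open>length Q = 2 * k - 3\<close>.\<close>

lemma spath_grow:
  assumes P: "spath a Q d" and Q: "length Q \<le> 2 * k - 3"
    and f: "f \<in> S" "f \<inter> set Q = {}" "f \<noteq> {a, d}"
  shows "\<exists>a' Q' d'. spath a' Q' d' \<and> length Q < length Q' \<and> length Q' \<le> 2 * k - 2"
proof -
  note R = spath_rev[OF P]
  have Qne: "Q \<noteq> []" and dist: "distinct (a # Q @ [d])" and succ: "successively (\<sim>) Q"
    using P by (auto simp: spath_def)
  have lQ: "length Q + 1 \<le> 2 * k - 2" using Q k_ge by auto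
  consider (a) w where "f = {w, a}" "w \<noteq> d" | (d) w where "f = {w, d}" "w \<noteq> a"
    | (disj) "f \<inter> set (a # Q @ [d]) = {}"
  proof (cases "a \<in> f \<or> d \<in> f")
    case True
    then show ?thesis
    proof
      assume "a \<in> f"
      then obtain w where "f = {a, w}" using S_edge_atE[OF f(1)] by blast
      then show ?thesis using a[of w] f(3) by (auto simp: insert_commute)
    next
      assume "d \<in> f"
      then obtain w where "f = {d, w}" using S_edge_atE[OF f(1)] by blast
      then show ?thesis using d[of w] f(3) by (auto simp: insert_commute)
    qed
  next
    case False
    then show ?thesis using disj f(2) by auto
  qed
  then show ?thesis
  proof cases
    case (a w)
    then show ?thesis using spath_Cons[OF P, of w] f lQ by force
  next
    case (d w)
    then show ?thesis using spath_Cons[OF R, of w] f lQ by force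
  next
    case disj
    have disj': "f \<inter> set (d # rev Q @ [a]) = {}" using disj by auto
    from P f(1) disj show ?thesis
    proof (cases rule: spath_attachedE)
      case (near y z)
      then show ?thesis using spath_extend1[OF P, of z y] f disj lQ by force
    next
      case (far y z)
      show ?thesis
      proof (cases "length Q = 2 * k - 3")
        case False
        then show ?thesis using spath_extend2[OF P, of z y] far f disj lQ by force
      next
        case True
        \<comment> \<open>Now the other end is tried. If \<open>f\<close> is attached to
          \<open>d\<close> as well as to \<open>a\<close>, a cycle on \<open>2 * k\<close> or
          \<open>2 * k + 1\<close> vertices arises, according to whether the same end of
          \<open>f\<close> is used.\<close>
        then have lQ': "Suc (Suc (Suc (length Q))) = 2 * k" using k_ge by auto
        from R f(1) disj' show ?thesis
        proof (cases rule: spath_attachedE)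
          case (near y z)
          then show ?thesis using spath_extend1[OF R, of z y] f disj' lQ by force
        next
          case far': (far y' z')
          have yz: "z \<sim> y" "y \<notin> set (a # Q @ [d])" "z \<notin> set (a # Q @ [d])" "y \<noteq> z"
            using far disj f(1) S_adj[of z y] adj_neq by auto
          have "\<not> d \<sim> y"
            using no_cycle[of "y # a # Q @ [d]"] dist succ Qne spath_adj[OF P] lQ' far yz
            by (auto simp: successively_Cons successively_append_iff)
          moreover have "\<not> d \<sim> z"
            using no_cycle[of "z # y # a # Q @ [d]"] dist succ Qne spath_adj[OF P] lQ' far yz
            by (auto simp: successively_Cons successively_append_iff)
          ultimately show ?thesis using far far' adj_sym by (auto simp: doubleton_eq_iff)
        qed
      qed
    qed
  qed
qed

text \<open>The edge \<open>f\<close> prolongs the path by exactly one vertex. The new interior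
  covers \<open>S\<close>, with the former first edge \<open>{a, hd Q}\<close> as the extra edge
  required for this, and its ends are adjacent, so the count for cycles applies.\<close>

lemma card_S_by_long_spath:
  assumes P: "spath a Q d" and Q: "length Q = 2 * k - 2"
    and f: "f \<in> S" "f \<inter> set Q = {}" "f \<inter> {a, d} = {} \<or> (a \<in> f \<and> d \<notin> f)"
  shows "card S + (2 * k - 1) \<le> (2 * k - 1) * D"
proof -
  have dist: "distinct (a # Q @ [d])" "{a, hd Q} \<in> S" using P by (auto simp: spath_def)
  have "\<exists>a' y. spath a' (y # Q) d"
    using f(3)
  proof
    assume "f \<inter> {a, d} = {}"
    then have disj: "f \<inter> set (a # Q @ [d]) = {}" using f(2) by auto
    with P f(1) show ?thesis
    proof (cases rule: spath_attachedE)
      case (near y z)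
      then show ?thesis using spath_extend1[OF P, of z y] f(1) disj by blast
    next
      case (far y z)
      then have "spath z (y # a # Q) d" using spath_extend2[OF P, of z y] f(1) disj by blast
      then show ?thesis using spath_length_neq Q k_ge by fastforce
    qed
  next
    assume a: "a \<in> f \<and> d \<notin> f"
    then obtain w where "f = {a, w}" using S_edge_atE f(1) by blast
    then show ?thesis using spath_Cons[OF P, of w] a f by (auto simp: insert_commute)
  qed
  then obtain a' y where P': "spath a' (y # Q) d" by blast
  have "\<And>f. f \<in> S \<Longrightarrow> f \<inter> set (y # Q) \<noteq> {}"
    using long_spath_covers[OF P' Q dist(2)] dist(1) by auto
  then have "card S \<le> card (inc (set (y # Q)))" by (rule card_S_le_inc)
  moreover have len: "length (y # Q) = 2 * k - 1" using Q k_ge by auto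
  moreover have "card (inc (set (y # Q))) + length (y # Q) \<le> length (y # Q) * D"
    using spath_ends[OF P'] P' len k_ge by (intro card_inc_cycle) (auto simp: spath_def)
  ultimately show ?thesis by simp
qed

lemma ex_spath:
  assumes "card S \<ge> 2"
  shows "\<exists>a Q d. spath a Q d \<and> length Q \<le> 2 * k - 2"
proof -
  obtain e f where ef: "e \<in> S" "f \<in> S" "e \<noteq> f"
    using assms by (metis card_le_Suc0_iff_eq finite_S not_less_eq_eq numeral_2_eq_2)
  have k: "2 \<le> 2 * k - 2" using k_ge by auto
  show ?thesis
  proof (cases "e \<inter> f = {}")
    case True
    then obtain x y where xy: "x \<in> e" "y \<in> f" "x \<sim> y" using attached ef by blast
    obtain x' y' where "e = {x, x'}" "x \<sim> x'" "f = {y, y'}" "y \<sim> y'"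
      using S_edge_atE ef xy by metis
    then have "spath x' [x, y] y'"
      using True ef xy adj_neq by (auto simp: spath_def insert_commute)
    then show ?thesis using k by force
  next
    case False
    then obtain x where x: "x \<in> e" "x \<in> f" by blast
    obtain y z where "e = {x, y}" "x \<sim> y" "f = {x, z}" "x \<sim> z"
      using S_edge_atE ef x by metis
    then have "spath y [x] z"
      using ef adj_neq by (auto simp: spath_def insert_commute)
    then show ?thesis using k by force
  qed
qed

text \<open>Take a longest path with interior of at most \<open>2 * k - 2\<close> vertices. Either
  its interior covers \<open>S\<close> up to \<open>{a, d}\<close>, or it has full length and can be
  prolonged once more at one of its ends.\<close>

lemma card_S_le:
  assumes "D \<ge> 1"
  shows "card S + (2 * k - 1) \<le> (2 * k - 1) * D + 2"
proof (cases "card S \<ge> 2")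
  case False
  then show ?thesis using mult_le_mono2[OF assms, of "2 * k - 1"] by linarith
next
  case True
  define L where "L = {length Q | Q. \<exists>a d. spath a Q d \<and> length Q \<le> 2 * k - 2}"
  have "finite L" unfolding L_def by (rule finite_subset[of _ "{..2 * k - 2}"]) auto
  moreover have "L \<noteq> {}" using ex_spath[OF True] by (auto simp: L_def)
  ultimately have "Max L \<in> L" and Max: "\<And>l. l \<in> L \<Longrightarrow> l \<le> Max L" by auto
  then obtain a Q d where P: "spath a Q d" "length Q \<le> 2 * k - 2" "length Q = Max L"
    by (auto simp: L_def)
  have le: "card S + (2 * k - 1) \<le> (2 * k - 1) * D + 2"
    if "\<And>f. f \<in> S \<Longrightarrow> f \<inter> set Q \<noteq> {} \<or> f = {a, d}"
  proof -
    have "card S + length Q \<le> length Q * D + 2" using card_S_by_inc_path P(1) that by blast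
    \<comment> \<open>A shorter interior gives a bound that is no weaker, since each of the
      \<open>j\<close> missing vertices would contribute \<open>D - 1 \<ge> 0\<close>.\<close>
    moreover obtain j where j: "2 * k - 1 = length Q + j"
      using le_Suc_ex[of "length Q" "2 * k - 1"] P(2) by fastforce
    moreover have "j \<le> j * D" using mult_le_mono2[OF assms, of j] by simp
    moreover have "(2 * k - 1) * D = length Q * D + j * D" unfolding j by (rule add_mult_distrib)
    ultimately show ?thesis by linarith
  qed
  show ?thesis
  proof (cases "\<exists>f\<in>S. f \<inter> set Q = {} \<and> f \<noteq> {a, d}")
    case False
    then show ?thesis using le by blast
  next
    case True
    then obtain f where f: "f \<in> S" "f \<inter> set Q = {}" "f \<noteq> {a, d}" by blast
    have "length Q = 2 * k - 2"
    proof (rule ccontr)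
      assume "length Q \<noteq> 2 * k - 2"
      then have "length Q \<le> 2 * k - 3" using P(2) by auto
      then obtain a' Q' d' where "spath a' Q' d'" "length Q < length Q'" "length Q' \<le> 2 * k - 2"
        using spath_grow[OF P(1) _ f] by blast
      then show False using Max[of "length Q'"] P(3) by (auto simp: L_def)
    qed
    moreover have "f \<inter> {a, d} = {} \<or> (a \<in> f \<and> d \<notin> f) \<or> (d \<in> f \<and> a \<notin> f)"
      using f S_edge_atE[OF f(1)] P(1) by (auto simp: spath_def)
    ultimately show ?thesis
      using card_S_by_long_spath[OF P(1) _ f(1,2)] card_S_by_long_spath[OF spath_rev[OF P(1)] _ f(1)] f(2)
      by fastforce
  qed
qed

end

section \<open>The three bounds\<close>

lemma degree_le_max_degree:
  assumes "simple_graph G" "v \<in> verts G"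
  shows "degree G v \<le> max_degree G"
  using assms unfolding max_degree_def simple_graph_def by (intro Max_ge) auto

text \<open>Integers keep \<open>\<Delta> - 1\<close> from being truncated. The lower bounds on
  \<open>\<Delta>\<close> in the last two parts exclude degenerate graphs: a single edge is a strong
  clique although 10k^2(\<Delta> - 1) vanishes for \<open>\<Delta> = 1\<close>, and the last bound
  is negative for \<open>\<Delta> = 0\<close>.\<close>

theorem theorem8:
  fixes G :: "'a ugraph" and \<Delta> :: nat
  assumes "simple_graph G" and "max_degree G = \<Delta>"
  shows
    "(\<Delta> \<ge> 4 \<longrightarrow> subgraph_free (cycle_graph 4) G \<longrightarrow>
        int (strong_clique_number G) \<le> 3 * (int \<Delta> - 1))
   \<and> (\<forall>k::nat. k \<ge> 3 \<longrightarrow> \<Delta> \<ge> 2 \<longrightarrow> subgraph_free (cycle_graph (2 * k)) G \<longrightarrow>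
        int (strong_clique_number G) \<le> 10 * (int k)\<^sup>2 * (int \<Delta> - 1))
   \<and> (\<forall>k::nat. k \<ge> 2 \<longrightarrow> \<Delta> \<ge> 1 \<longrightarrow>
        family_free {cycle_graph (2 * k), cycle_graph (2 * k + 1), cycle_graph (2 * k + 2)} G \<longrightarrow>
        int (strong_clique_number G) \<le> (2 * int k - 1) * (int \<Delta> - 1) + 2)"
proof (intro conjI allI impI)
  have cg: "clique_graph G S \<Delta>" if "strong_clique G S" for S
    using assms degree_le_max_degree[of G] that by unfold_locales auto
  have bound: "int (strong_clique_number G) \<le> N"
    if "0 \<le> N" "\<And>S. strong_clique G S \<Longrightarrow> int (card S) \<le> N" for N
    using strong_clique_number_le[OF assms(1), of "nat N"] that by (simp add: le_nat_iff)
  note free = clique_graph.cycle_free_def[OF cg]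
  {
    assume D: "\<Delta> \<ge> 4" and cf: "subgraph_free (cycle_graph 4) G"
    show "int (strong_clique_number G) \<le> 3 * (int \<Delta> - 1)"
    proof (rule bound)
      fix S assume S: "strong_clique G S"
      interpret four_cycle_free G S \<Delta>
        using cg[OF S] cf free[OF S] by (simp add: four_cycle_free_def four_cycle_free_axioms_def)
      have "int (card S + 3) \<le> int (3 * \<Delta>)" using card_S_le[OF D] by (simp only: of_nat_le_iff)
      then show "int (card S) \<le> 3 * (int \<Delta> - 1)" by simp
    qed (use D in simp)
  next
    fix k :: nat
    assume k: "k \<ge> 3" and D: "\<Delta> \<ge> 2" and cf: "subgraph_free (cycle_graph (2 * k)) G"
    show "int (strong_clique_number G) \<le> 10 * (int k)\<^sup>2 * (int \<Delta> - 1)"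
    proof (rule bound)
      fix S assume S: "strong_clique G S"
      interpret even_cycle_free G S \<Delta> k
        using cg[OF S] cf k free[OF S] by (simp add: even_cycle_free_def even_cycle_free_axioms_def)
      have "int (card S + 10 * k\<^sup>2) \<le> int (10 * k\<^sup>2 * \<Delta>)"
        using card_S_le[OF D] by (simp only: of_nat_le_iff)
      then show "int (card S) \<le> 10 * (int k)\<^sup>2 * (int \<Delta> - 1)" by (simp add: algebra_simps)
    qed (use D in simp)
  next
    fix k :: nat
    assume k: "k \<ge> 2" and D: "\<Delta> \<ge> 1"
      and cf: "family_free {cycle_graph (2 * k), cycle_graph (2 * k + 1), cycle_graph (2 * k + 2)} G"
    show "int (strong_clique_number G) \<le> (2 * int k - 1) * (int \<Delta> - 1) + 2"
    proof (rule bound)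
      fix S assume S: "strong_clique G S"
      interpret three_cycle_free G S \<Delta> k
        using cg[OF S] cf k free[OF S]
        by (simp add: three_cycle_free_def three_cycle_free_axioms_def family_free_def)
      have "int (card S + (2 * k - 1)) \<le> int ((2 * k - 1) * \<Delta> + 2)"
        using card_S_le[OF D] by (simp only: of_nat_le_iff)
      moreover have "int (2 * k - 1) = 2 * int k - 1" using k by (simp add: of_nat_diff)
      ultimately show "int (card S) \<le> (2 * int k - 1) * (int \<Delta> - 1) + 2"
        by (simp add: algebra_simps)
    qed (use k D in simp)
  }
qed

end
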